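(* Let $G$ be a finite $5$-group of nilpotency class $5$. Then $\exp(G\wedge G)$ divides $\exp(G)$.
   Context: Conventions: ${}^g h = ghg^{-1}$, $[g,h]=ghg^{-1}h^{-1}$. The nonabelian tensor square $G\otimes G$ is generated by symbols $g\otimes h$ subject to $gg'\otimes h=({}^g g'\otimes {}^g h)(g\otimes h)$ and $g\otimes hh'=(g\otimes h)({}^h g\otimes {}^h h')$; the exterior square $G\wedge G$ is its quotient by the subgroup generated by all $x\otimes x$. *)

theory Defs
  imports "HOL-Algebra.Algebra"
begin

text \<open>Words in the free group on generators of type 'x: a letter (True, x) is x,
  a letter (False, x) is x inverse.\<close>
type_synonym 'x word = "(bool \<times> 'x) list"

text \<open>The congruence on words generated by free cancellation and the relators R
  (i.e. equality in the free group modulo the normal closure of R).\<close>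
inductive word_eqv :: "'x word set \<Rightarrow> 'x word \<Rightarrow> 'x word \<Rightarrow> bool" for R where
  weq_refl: "word_eqv R u u"
| weq_sym: "word_eqv R u v \<Longrightarrow> word_eqv R v u"
| weq_trans: "word_eqv R u v \<Longrightarrow> word_eqv R v w \<Longrightarrow> word_eqv R u w"
| weq_append: "word_eqv R u u' \<Longrightarrow> word_eqv R v v' \<Longrightarrow> word_eqv R (u @ v) (u' @ v')"
| weq_cancel: "word_eqv R [(b, x), (\<not> b, x)] []"
| weq_rel: "r \<in> R \<Longrightarrow> word_eqv R r []"

text \<open>The group with generators X and relators R (R consists of words over X).\<close>
definition presentation :: "'x set \<Rightarrow> 'x word set \<Rightarrow> 'x word set monoid" where
  "presentation Gens R =
     \<lparr> carrier = (\<lambda>w. {v. word_eqv R w v}) ` {w. set (map snd w) \<subseteq> Gens},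
       monoid.mult = (\<lambda>A B. {w. \<exists>u\<in>A. \<exists>v\<in>B. word_eqv R (u @ v) w}),
       one = {w. word_eqv R [] w} \<rparr>"

definition conj :: "('a, 'b) monoid_scheme \<Rightarrow> 'a \<Rightarrow> 'a \<Rightarrow> 'a" where
  "conj G g h = g \<otimes>\<^bsub>G\<^esub> h \<otimes>\<^bsub>G\<^esub> inv\<^bsub>G\<^esub> g"

text \<open>Defining relators of the tensor square; the generator (g, h) stands for g \<otimes> h.
  gg' \<otimes> h = (conj g g' \<otimes> conj g h)(g \<otimes> h) and g \<otimes> hh' = (g \<otimes> h)(conj h g \<otimes> conj h h').\<close>
definition tensor_relators :: "('a, 'b) monoid_scheme \<Rightarrow> ('a \<times> 'a) word set" where
  "tensor_relators G =
     {[(True, (g \<otimes>\<^bsub>G\<^esub> g', h)), (False, (g, h)), (False, (conj G g g', conj G g h))]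
       | g g' h. g \<in> carrier G \<and> g' \<in> carrier G \<and> h \<in> carrier G}
   \<union> {[(True, (g, h \<otimes>\<^bsub>G\<^esub> h')), (False, (conj G h g, conj G h h')), (False, (g, h))]
       | g h h'. g \<in> carrier G \<and> h \<in> carrier G \<and> h' \<in> carrier G}"

definition tensor_square :: "('a, 'b) monoid_scheme \<Rightarrow> ('a \<times> 'a) word set monoid" where
  "tensor_square G = presentation (carrier G \<times> carrier G) (tensor_relators G)"

definition exterior_square :: "('a, 'b) monoid_scheme \<Rightarrow> ('a \<times> 'a) word set monoid" where
  "exterior_square G = presentation (carrier G \<times> carrier G)
     (tensor_relators G \<union> {[(True, (g, g))] | g. g \<in> carrier G})"

definition group_exponent :: "('a, 'b) monoid_scheme \<Rightarrow> nat" where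
  "group_exponent G =
     (if \<exists>n::nat>0. \<forall>x\<in>carrier G. x [^]\<^bsub>G\<^esub> n = \<one>\<^bsub>G\<^esub>
      then LEAST n::nat. n > 0 \<and> (\<forall>x\<in>carrier G. x [^]\<^bsub>G\<^esub> n = \<one>\<^bsub>G\<^esub>)
      else 0)"

definition commutator :: "('a, 'b) monoid_scheme \<Rightarrow> 'a \<Rightarrow> 'a \<Rightarrow> 'a" where
  "commutator G g h = g \<otimes>\<^bsub>G\<^esub> h \<otimes>\<^bsub>G\<^esub> inv\<^bsub>G\<^esub> g \<otimes>\<^bsub>G\<^esub> inv\<^bsub>G\<^esub> h"

text \<open>Lower central series, indexed from 0: lcs G 0 = G = gamma_1, lcs G i = gamma_(i+1).\<close>
fun lcs :: "('a, 'b) monoid_scheme \<Rightarrow> nat \<Rightarrow> 'a set" where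
  "lcs G 0 = carrier G"
| "lcs G (Suc i) = generate G {commutator G g h | g h. g \<in> lcs G i \<and> h \<in> carrier G}"

definition nilpotency_class :: "('a, 'b) monoid_scheme \<Rightarrow> nat \<Rightarrow> bool" where
  "nilpotency_class G c \<longleftrightarrow> lcs G c = {\<one>\<^bsub>G\<^esub>} \<and> (\<forall>d<c. lcs G d \<noteq> {\<one>\<^bsub>G\<^esub>})"

end

theory Submission
  imports Defs
begin

text \<open>Write $M = G \wedge G$ and filter it by the subgroups $W_k$ generated by the $g \wedge h$
  with $g \in \gamma_{k+1}(G)$; the index is that of lcs, so $W_0 = M$ and $W_5 = 1$. They behave like
  the terms $\gamma_{k+2}$ of a covering group: the operators $\delta_x m = m^{-1} \cdot {}^x m$ raise
  the filtration, by $j + 1$ if $x$ lies in lcs $G$ $j$. Let $q$ be the exponent of $G$.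

  For $c = y \wedge x$ the element $y \wedge x^q = 1$ is the twisted power
  $c \cdot {}^x c \cdots {}^{x^{q-1}} c$. Its expansion has exponents $\binom q i$ with $i \le 5$, and
  only $\binom q 5$ fails to be divisible by $q$. Descending on $k$ this gives $W_k^q = 1$ for
  $k \ge 1$, and $c^q (\delta_x^4 c)^{\binom q 5} = 1$ in general.

  Since $y \wedge x y^i = y \wedge x$, the power $(\delta_{x y^i}^4 c)^{\binom q 5}$ does not depend
  on $i$. It is a polynomial in $i$ of degree 4 with values in a group of exponent 5 and with leading
  coefficient $(\delta_y^4 c)^{\binom q 5}$, which is therefore trivial. Exchanging $x$ and $y$
  gives $c^q = 1$.\<close>

section \<open>Groups given by generators and relators\<close>

abbreviation word_class :: "'x word set \<Rightarrow> 'x word \<Rightarrow> 'x word set"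
  where "word_class R w \<equiv> {v. word_eqv R w v}"

lemma word_class_eq_iff: "word_class R u = word_class R v \<longleftrightarrow> word_eqv R u v"
  by (blast intro: weq_refl weq_sym weq_trans)

lemma presentation_mult:
  "word_class R u \<otimes>\<^bsub>presentation Y R\<^esub> word_class R v = word_class R (u @ v)"
proof -
  have "word_eqv R (u' @ v') w \<Longrightarrow> word_eqv R (u @ v) w" if "word_eqv R u u'" "word_eqv R v v'" for u' v' w
    by (meson that weq_append weq_trans)
  then show ?thesis
    by (auto simp: presentation_def intro: weq_refl)
qed

lemma presentation_one: "\<one>\<^bsub>presentation Y R\<^esub> = word_class R []"
  by (simp add: presentation_def)

lemma presentation_carrier:
  "carrier (presentation Y R) = word_class R ` {w. set (map snd w) \<subseteq> Y}"
  by (simp add: presentation_def)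

definition inv_word :: "'x word \<Rightarrow> 'x word"
  where "inv_word w = map (\<lambda>(b, x). (\<not> b, x)) (rev w)"

lemma inv_word_append: "word_eqv R (inv_word w @ w) []"
proof (induction w)
  case Nil
  then show ?case by (simp add: inv_word_def weq_refl)
next
  case (Cons a w)
  obtain b x where a: "a = (b, x)" by force
  have "word_eqv R [(\<not> b, x), (b, x)] []"
    using weq_cancel[of R "\<not> b" x] by simp
  then have "word_eqv R (inv_word w @ [(\<not> b, x), (b, x)] @ w) (inv_word w @ [] @ w)"
    by (intro weq_append weq_refl)
  then have "word_eqv R (inv_word w @ [(\<not> b, x), (b, x)] @ w) []"
    using Cons.IH by (simp only: append_Nil) (rule weq_trans)
  moreover have "inv_word w @ [(\<not> b, x), (b, x)] @ w = inv_word (a # w) @ a # w"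
    by (simp add: inv_word_def a)
  ultimately show ?case
    by (simp only:)
qed

lemma group_presentation: "group (presentation Y R)"
proof (rule groupI)
  fix A B assume "A \<in> carrier (presentation Y R)" "B \<in> carrier (presentation Y R)"
  then obtain u v where "A = word_class R u" "set (map snd u) \<subseteq> Y"
      "B = word_class R v" "set (map snd v) \<subseteq> Y"
    unfolding presentation_carrier by blast
  then show "A \<otimes>\<^bsub>presentation Y R\<^esub> B \<in> carrier (presentation Y R)"
    unfolding presentation_carrier by (intro image_eqI[of _ _ "u @ v"]) (auto simp: presentation_mult)
next
  show "\<one>\<^bsub>presentation Y R\<^esub> \<in> carrier (presentation Y R)"
    unfolding presentation_carrier presentation_one by (rule imageI) simp
next
  fix A B C
  assume "A \<in> carrier (presentation Y R)" "B \<in> carrier (presentation Y R)"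
    "C \<in> carrier (presentation Y R)"
  then show "A \<otimes>\<^bsub>presentation Y R\<^esub> B \<otimes>\<^bsub>presentation Y R\<^esub> C
    = A \<otimes>\<^bsub>presentation Y R\<^esub> (B \<otimes>\<^bsub>presentation Y R\<^esub> C)"
    unfolding presentation_carrier by (auto simp: presentation_mult)
next
  fix A assume "A \<in> carrier (presentation Y R)"
  then show "\<one>\<^bsub>presentation Y R\<^esub> \<otimes>\<^bsub>presentation Y R\<^esub> A = A"
    unfolding presentation_carrier by (auto simp: presentation_mult presentation_one)
next
  fix A assume "A \<in> carrier (presentation Y R)"
  then obtain w where w: "A = word_class R w" "set (map snd w) \<subseteq> Y"
    unfolding presentation_carrier by blast
  have "set (map snd (inv_word w)) \<subseteq> Y"
    using w(2) by (auto simp: inv_word_def)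
  moreover have "word_class R (inv_word w) \<otimes>\<^bsub>presentation Y R\<^esub> A = \<one>\<^bsub>presentation Y R\<^esub>"
    unfolding w(1) presentation_mult presentation_one word_class_eq_iff by (rule inv_word_append)
  ultimately show "\<exists>B\<in>carrier (presentation Y R). B \<otimes>\<^bsub>presentation Y R\<^esub> A = \<one>\<^bsub>presentation Y R\<^esub>"
    unfolding presentation_carrier by blast
qed

lemma presentation_inv_letter:
  assumes "x \<in> Y"
  shows "inv\<^bsub>presentation Y R\<^esub> word_class R [(True, x)] = word_class R [(False, x)]"
proof -
  interpret P: group "presentation Y R" by (rule group_presentation)
  have c: "word_class R [(b, x)] \<in> carrier (presentation Y R)" for b
    unfolding presentation_carrier using assms by (intro imageI) simp
  have "word_class R [(False, x)] \<otimes>\<^bsub>presentation Y R\<^esub> word_class R [(True, x)] = \<one>\<^bsub>presentation Y R\<^esub>"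
    unfolding presentation_mult presentation_one word_class_eq_iff
    using weq_cancel[of R False x] by simp
  then show ?thesis using c P.inv_equality by blast
qed

lemma presentation_generate:
  "carrier (presentation Y R) = generate (presentation Y R) ((\<lambda>x. word_class R [(True, x)]) ` Y)"
    (is "_ = generate ?P ?S")
proof
  interpret P: group ?P by (rule group_presentation)
  have S: "?S \<subseteq> carrier ?P"
    unfolding presentation_carrier by force
  then show "generate ?P ?S \<subseteq> carrier ?P"
    by (rule P.generate_incl)
  have "word_class R w \<in> generate ?P ?S" if "set (map snd w) \<subseteq> Y" for w
    using that
  proof (induction w)
    case Nil
    show ?case using generate.one[of ?P ?S] by (simp add: presentation_one)
  next
    case (Cons a w)
    obtain b x where a: "a = (b, x)" by force
    have x: "x \<in> Y" using Cons.prems a by simp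
    have "word_class R [(b, x)] \<in> generate ?P ?S"
    proof (cases b)
      case True
      then show ?thesis using x by (auto intro: generate.incl)
    next
      case False
      then have "word_class R [(b, x)] = inv\<^bsub>?P\<^esub> word_class R [(True, x)]"
        using x by (simp add: presentation_inv_letter)
      also have "\<dots> \<in> generate ?P ?S"
        using x by (blast intro: generate.inv)
      finally show ?thesis .
    qed
    moreover have "word_class R w \<in> generate ?P ?S"
      using Cons by simp
    ultimately have "word_class R [(b, x)] \<otimes>\<^bsub>?P\<^esub> word_class R w \<in> generate ?P ?S"
      by (rule generate.eng)
    then show ?case by (simp add: presentation_mult a)
  qed
  then show "carrier ?P \<subseteq> generate ?P ?S"
    unfolding presentation_carrier by blast
qed

section \<open>Evaluation of words and the universal property of a presentation\<close>

fun letter_val :: "('g, 'b) monoid_scheme \<Rightarrow> ('x \<Rightarrow> 'g) \<Rightarrow> bool \<times> 'x \<Rightarrow> 'g"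
  where "letter_val L f (b, x) = (if b then f x else inv\<^bsub>L\<^esub> f x)"

definition word_val :: "('g, 'b) monoid_scheme \<Rightarrow> ('x \<Rightarrow> 'g) \<Rightarrow> 'x word \<Rightarrow> 'g"
  where "word_val L f w = foldr (\<lambda>a y. letter_val L f a \<otimes>\<^bsub>L\<^esub> y) w \<one>\<^bsub>L\<^esub>"

text \<open>\<open>the_elem\<close> picks the common value of \<open>word_val\<close> on a class.
  Such a value exists as soon as every relator evaluates to the identity, and then this is the
  homomorphism induced by \<open>f\<close>.\<close>

definition presentation_lift :: "('g, 'b) monoid_scheme \<Rightarrow> ('x \<Rightarrow> 'g) \<Rightarrow> 'x word set \<Rightarrow> 'g"
  where "presentation_lift L f A = the_elem (word_val L f ` A)"

context group
begin

lemma word_val_simps [simp]: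
  "word_val G f [] = \<one>" "word_val G f (a # w) = letter_val G f a \<otimes> word_val G f w"
  by (simp_all add: word_val_def)

context
  fixes f :: "'x \<Rightarrow> 'a" and R :: "'x word set"
  assumes f: "\<And>x. f x \<in> carrier G"
begin

lemma letter_val_closed [simp]: "letter_val G f a \<in> carrier G"
  using f by (cases a) simp

lemma word_val_closed [simp]: "word_val G f w \<in> carrier G"
  by (induction w) auto

lemma word_val_append: "word_val G f (u @ v) = word_val G f u \<otimes> word_val G f v"
  by (induction u) (auto simp: m_assoc)

context
  assumes R: "\<And>r. r \<in> R \<Longrightarrow> word_val G f r = \<one>"
begin

lemma word_val_cong: "word_eqv R u v \<Longrightarrow> word_val G f u = word_val G f v"
proof (induction rule: word_eqv.induct)
  case (weq_cancel b x)
  then show ?case using f by (cases b) auto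
qed (auto simp: word_val_append R)

lemma presentation_lift_class: "presentation_lift G f (word_class R w) = word_val G f w"
proof -
  have "word_val G f ` word_class R w = {word_val G f w}"
  proof
    show "word_val G f ` word_class R w \<subseteq> {word_val G f w}"
      by (auto dest: word_val_cong)
    show "{word_val G f w} \<subseteq> word_val G f ` word_class R w"
      by (auto intro: weq_refl)
  qed
  then show ?thesis by (simp add: presentation_lift_def)
qed

lemma presentation_lift_hom: "presentation_lift G f \<in> hom (presentation Y R) G"
  by (rule homI) (auto simp: presentation_carrier presentation_mult presentation_lift_class word_val_append)

lemma presentation_lift_letter: "presentation_lift G f (word_class R [(True, x)]) = f x"
  using f by (simp add: presentation_lift_class)

end
end
end

lemma hom_eq_on_generate:
  assumes "group G" "group H" "f \<in> hom G H" "g \<in> hom G H" "S \<subseteq> carrier G"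
    and eq: "\<And>s. s \<in> S \<Longrightarrow> f s = g s"
    and "x \<in> generate G S"
  shows "f x = g x"
proof -
  interpret f: group_hom G H f using assms by (simp add: group_hom_def group_hom_axioms_def)
  interpret g: group_hom G H g using assms by (simp add: group_hom_def group_hom_axioms_def)
  have sub: "generate G S \<subseteq> carrier G" using assms(5) by (rule f.G.generate_incl)
  from \<open>x \<in> generate G S\<close> show ?thesis
  proof (induction rule: generate.induct)
    case (eng h1 h2)
    then show ?case using sub by (auto simp: subset_iff)
  qed (use assms(5) eq in \<open>auto simp: subset_iff\<close>)
qed

section \<open>Identities for conjugation and commutators\<close>

context group
begin

lemma inv_mult_cancel [simp]:
  assumes "x \<in> carrier G" "y \<in> carrier G"
  shows "inv x \<otimes> (x \<otimes> y) = y" "x \<otimes> (inv x \<otimes> y) = y"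
  using assms by (simp_all add: m_assoc[symmetric])

lemma conj_closed [simp]: "x \<in> carrier G \<Longrightarrow> g \<in> carrier G \<Longrightarrow> conj G x g \<in> carrier G"
  by (simp add: conj_def)

lemma conj_one [simp]: "g \<in> carrier G \<Longrightarrow> conj G \<one> g = g"
  by (simp add: conj_def)

lemma conj_self [simp]: "g \<in> carrier G \<Longrightarrow> conj G g g = g"
  by (simp add: conj_def m_assoc)

lemma conj_inv_cancel [simp]:
  assumes "x \<in> carrier G" "g \<in> carrier G"
  shows "conj G (inv x) (conj G x g) = g" "conj G x (conj G (inv x) g) = g"
  using assms by (simp_all add: conj_def m_assoc)

lemma conj_mult_left:
  "x \<in> carrier G \<Longrightarrow> y \<in> carrier G \<Longrightarrow> g \<in> carrier G
    \<Longrightarrow> conj G (x \<otimes> y) g = conj G x (conj G y g)"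
  by (simp add: conj_def m_assoc inv_mult_group)

lemma conj_mult:
  "x \<in> carrier G \<Longrightarrow> g \<in> carrier G \<Longrightarrow> h \<in> carrier G
    \<Longrightarrow> conj G x (g \<otimes> h) = conj G x g \<otimes> conj G x h"
  by (simp add: conj_def m_assoc)

lemma conj_conj:
  "x \<in> carrier G \<Longrightarrow> y \<in> carrier G \<Longrightarrow> g \<in> carrier G
    \<Longrightarrow> conj G (conj G x y) (conj G x g) = conj G x (conj G y g)"
  by (simp add: conj_def m_assoc inv_mult_group)

lemma commutator_closed [simp]:
  "g \<in> carrier G \<Longrightarrow> h \<in> carrier G \<Longrightarrow> commutator G g h \<in> carrier G"
  by (simp add: commutator_def)

lemma conj_commutator:
  "x \<in> carrier G \<Longrightarrow> g \<in> carrier G \<Longrightarrow> h \<in> carrier G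
    \<Longrightarrow> conj G x (commutator G g h) = commutator G (conj G x g) (conj G x h)"
  by (simp add: conj_def commutator_def m_assoc inv_mult_group)

lemma commutator_mult_left:
  "g \<in> carrier G \<Longrightarrow> g' \<in> carrier G \<Longrightarrow> h \<in> carrier G
    \<Longrightarrow> commutator G (g \<otimes> g') h = commutator G (conj G g g') (conj G g h) \<otimes> commutator G g h"
  by (simp add: conj_def commutator_def m_assoc inv_mult_group)

lemma commutator_mult_right:
  "g \<in> carrier G \<Longrightarrow> h \<in> carrier G \<Longrightarrow> h' \<in> carrier G
    \<Longrightarrow> commutator G g (h \<otimes> h') = commutator G g h \<otimes> commutator G (conj G h g) (conj G h h')"
  by (simp add: conj_def commutator_def m_assoc inv_mult_group)

lemma commutator_self [simp]: "g \<in> carrier G \<Longrightarrow> commutator G g g = \<one>"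
  by (simp add: commutator_def m_assoc)

lemma commutator_mult_swap:
  "g \<in> carrier G \<Longrightarrow> h \<in> carrier G \<Longrightarrow> commutator G g h \<otimes> (h \<otimes> g) = g \<otimes> h"
  by (simp add: commutator_def m_assoc)

lemma conj_hom_self: "x \<in> carrier G \<Longrightarrow> conj G x \<in> hom G G"
  by (rule homI) (auto simp: conj_mult)

end

section \<open>The exterior square as a crossed module\<close>

text \<open>The interface through which the exterior square is used: a generating pairing together
  with maps \<open>act x\<close> and \<open>bd\<close> whose values on the generators are
  prescribed. That \<open>act\<close> is an action and that \<open>bd\<close> is a crossed module
  over it is derived below from the two product rules.\<close>

locale exterior_pairing = G: group G + M: group M
  for G :: "('a, 'b) monoid_scheme" and M :: "('m, 'n) monoid_scheme" (structure) +
  fixes wedge :: "'a \<Rightarrow> 'a \<Rightarrow> 'm" and act :: "'a \<Rightarrow> 'm \<Rightarrow> 'm" and bd :: "'m \<Rightarrow> 'a"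
  assumes wedge_closed [simp]: "g \<in> carrier G \<Longrightarrow> h \<in> carrier G \<Longrightarrow> wedge g h \<in> carrier M"
    and carrier_generate: "carrier M = generate M {wedge g h | g h. g \<in> carrier G \<and> h \<in> carrier G}"
    and act_hom: "x \<in> carrier G \<Longrightarrow> act x \<in> hom M M"
    and act_wedge: "x \<in> carrier G \<Longrightarrow> g \<in> carrier G \<Longrightarrow> h \<in> carrier G
      \<Longrightarrow> act x (wedge g h) = wedge (conj G x g) (conj G x h)"
    and bd_hom: "bd \<in> hom M G"
    and bd_wedge: "g \<in> carrier G \<Longrightarrow> h \<in> carrier G \<Longrightarrow> bd (wedge g h) = commutator G g h"
    and wedge_mult_left_conj: "g \<in> carrier G \<Longrightarrow> g' \<in> carrier G \<Longrightarrow> h \<in> carrier G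
      \<Longrightarrow> wedge (g \<otimes>\<^bsub>G\<^esub> g') h = wedge (conj G g g') (conj G g h) \<otimes> wedge g h"
    and wedge_mult_right_conj: "g \<in> carrier G \<Longrightarrow> h \<in> carrier G \<Longrightarrow> h' \<in> carrier G
      \<Longrightarrow> wedge g (h \<otimes>\<^bsub>G\<^esub> h') = wedge g h \<otimes> wedge (conj G h g) (conj G h h')"
    and wedge_self [simp]: "g \<in> carrier G \<Longrightarrow> wedge g g = \<one>"
begin

lemma act_closed [simp]: "x \<in> carrier G \<Longrightarrow> m \<in> carrier M \<Longrightarrow> act x m \<in> carrier M"
  using act_hom by (auto simp: hom_def)

lemma act_mult: "x \<in> carrier G \<Longrightarrow> m \<in> carrier M \<Longrightarrow> n \<in> carrier M
    \<Longrightarrow> act x (m \<otimes> n) = act x m \<otimes> act x n"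
  using act_hom by (auto simp: hom_def)

lemma act_group_hom: "x \<in> carrier G \<Longrightarrow> group_hom M M (act x)"
  by (simp add: act_hom group_hom_def group_hom_axioms_def M.is_group)

lemma act_one [simp]: "x \<in> carrier G \<Longrightarrow> act x \<one> = \<one>"
  using group_hom.hom_one[OF act_group_hom] .

lemma act_inv: "x \<in> carrier G \<Longrightarrow> m \<in> carrier M \<Longrightarrow> act x (inv m) = inv act x m"
  using group_hom.hom_inv[OF act_group_hom] .

lemma hom_eq:
  assumes "group H" "f \<in> hom M H" "g \<in> hom M H"
    and eq: "\<And>g' h. g' \<in> carrier G \<Longrightarrow> h \<in> carrier G \<Longrightarrow> f (wedge g' h) = g (wedge g' h)"
    and "m \<in> carrier M"
  shows "f m = g m"
  by (rule hom_eq_on_generate[where G = M and H = H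
        and S = "{wedge g h | g h. g \<in> carrier G \<and> h \<in> carrier G}"])
    (use assms carrier_generate in auto)

lemma act_act:
  assumes x: "x \<in> carrier G" and y: "y \<in> carrier G" and m: "m \<in> carrier M"
  shows "act (x \<otimes>\<^bsub>G\<^esub> y) m = act x (act y m)"
proof (rule hom_eq[where H = M, OF _ _ _ _ m])
  show "(\<lambda>m. act x (act y m)) \<in> hom M M"
    using x y by (intro homI) (auto simp: act_mult)
qed (use x y in \<open>auto simp: act_hom act_wedge G.conj_mult_left\<close>)

lemma act_one_left [simp]: "m \<in> carrier M \<Longrightarrow> act \<one>\<^bsub>G\<^esub> m = m"
  by (rule hom_eq[where H = M and g = "\<lambda>m. m"]) (auto simp: act_hom act_wedge intro: homI)

lemma act_inv_left [simp]:
  assumes "x \<in> carrier G" "m \<in> carrier M"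
  shows "act (inv\<^bsub>G\<^esub> x) (act x m) = m" "act x (act (inv\<^bsub>G\<^esub> x) m) = m"
  using assms by (simp_all flip: act_act)

lemma wedge_mult_left: "g \<in> carrier G \<Longrightarrow> g' \<in> carrier G \<Longrightarrow> h \<in> carrier G
    \<Longrightarrow> wedge (g \<otimes>\<^bsub>G\<^esub> g') h = act g (wedge g' h) \<otimes> wedge g h"
  by (simp add: wedge_mult_left_conj act_wedge)

lemma wedge_mult_right: "g \<in> carrier G \<Longrightarrow> h \<in> carrier G \<Longrightarrow> h' \<in> carrier G
    \<Longrightarrow> wedge g (h \<otimes>\<^bsub>G\<^esub> h') = wedge g h \<otimes> act h (wedge g h')"
  by (simp add: wedge_mult_right_conj act_wedge)

lemma wedge_one_left [simp]: "h \<in> carrier G \<Longrightarrow> wedge \<one>\<^bsub>G\<^esub> h = \<one>"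
  using wedge_mult_left[of "\<one>\<^bsub>G\<^esub>" "\<one>\<^bsub>G\<^esub>" h] by simp

lemma wedge_one_right [simp]: "g \<in> carrier G \<Longrightarrow> wedge g \<one>\<^bsub>G\<^esub> = \<one>"
  using wedge_mult_right[of g "\<one>\<^bsub>G\<^esub>" "\<one>\<^bsub>G\<^esub>"] by simp

text \<open>Expanding the trivial element \<open>wedge (x y) (x y)\<close> in both arguments leaves
  only the mixed terms, namely \<open>act x\<close> applied to \<open>wedge y x\<close> times
  \<open>wedge x y\<close>.\<close>

lemma wedge_swap:
  assumes x: "x \<in> carrier G" and y: "y \<in> carrier G"
  shows "wedge y x = inv wedge x y"
proof -
  have "\<one> = wedge (x \<otimes>\<^bsub>G\<^esub> y) (x \<otimes>\<^bsub>G\<^esub> y)"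
    using x y by simp
  also have "\<dots> = act x (wedge y (x \<otimes>\<^bsub>G\<^esub> y)) \<otimes> wedge x (x \<otimes>\<^bsub>G\<^esub> y)"
    using x y by (simp add: wedge_mult_left del: wedge_self)
  also have "\<dots> = act x (wedge y x \<otimes> wedge x y)"
    using x y by (simp add: wedge_mult_right act_mult)
  finally have "act (inv\<^bsub>G\<^esub> x) (act x (wedge y x \<otimes> wedge x y)) = act (inv\<^bsub>G\<^esub> x) \<one>"
    by (rule arg_cong[OF sym])
  then have "wedge y x \<otimes> wedge x y = \<one>"
    using x y by simp
  then show ?thesis using x y by (simp add: M.inv_equality)
qed

text \<open>The Peiffer identity for a generator. The two expansions of
  \<open>wedge (g g') (h h')\<close> share their outer factors; cancelling these compares the
  actions of \<open>g h\<close> and \<open>h g\<close>, which differ by the commutator.\<close>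

lemma act_commutator_wedge:
  assumes g: "g \<in> carrier G" and h: "h \<in> carrier G" and m: "m \<in> carrier M"
  shows "act (commutator G g h) m = conj M (wedge g h) m"
proof (rule hom_eq[where H = M, OF _ _ _ _ m])
  fix a b assume a: "a \<in> carrier G" and b: "b \<in> carrier G"
  \<comment> \<open>The comparison produces \<open>act (h g) (wedge g' h')\<close>. This choice of
    \<open>g'\<close> and \<open>h'\<close> makes that element the arbitrary generator
    \<open>wedge a b\<close>.\<close>
  define g' h' where "g' = conj G (inv\<^bsub>G\<^esub> (h \<otimes>\<^bsub>G\<^esub> g)) a" and "h' = conj G (inv\<^bsub>G\<^esub> (h \<otimes>\<^bsub>G\<^esub> g)) b"
  have [simp]: "g' \<in> carrier G" "h' \<in> carrier G"
    using a b g h by (simp_all add: g'_def h'_def)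
  have ab: "wedge a b = act (h \<otimes>\<^bsub>G\<^esub> g) (wedge g' h')"
    using a b g h by (simp add: act_wedge, simp add: g'_def h'_def)
  \<comment> \<open>expand \<open>wedge (g g') (h h')\<close> in two ways\<close>
  have "wedge (g \<otimes>\<^bsub>G\<^esub> g') (h \<otimes>\<^bsub>G\<^esub> h') =
      act g (wedge g' h) \<otimes> (act g (act h (wedge g' h')) \<otimes> (wedge g h \<otimes> act h (wedge g h')))"
    using g h by (subst wedge_mult_left)
      (simp_all add: wedge_mult_right act_mult M.m_assoc)
  moreover have "wedge (g \<otimes>\<^bsub>G\<^esub> g') (h \<otimes>\<^bsub>G\<^esub> h') =
      act g (wedge g' h) \<otimes> (wedge g h \<otimes> (act h (act g (wedge g' h')) \<otimes> act h (wedge g h')))"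
    using g h by (subst wedge_mult_right)
      (simp_all add: wedge_mult_left act_mult M.m_assoc)
  ultimately have "act g (act h (wedge g' h')) \<otimes> (wedge g h \<otimes> act h (wedge g h'))
      = wedge g h \<otimes> (act h (act g (wedge g' h')) \<otimes> act h (wedge g h'))"
    using g h by simp
  then have "act g (act h (wedge g' h')) \<otimes> wedge g h = wedge g h \<otimes> act h (act g (wedge g' h'))"
    using g h M.r_cancel[of "act h (wedge g h')"] by (simp flip: M.m_assoc)
  then have "act (commutator G g h \<otimes>\<^bsub>G\<^esub> (h \<otimes>\<^bsub>G\<^esub> g)) (wedge g' h') \<otimes> wedge g h = wedge g h \<otimes> wedge a b"
    using g h by (simp add: ab act_act G.commutator_mult_swap del: G.m_closed)
  then have "act (commutator G g h) (wedge a b) \<otimes> wedge g h = wedge g h \<otimes> wedge a b"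
    using g h by (simp add: ab act_act)
  then show "act (commutator G g h) (wedge a b) = conj M (wedge g h) (wedge a b)"
    using a b g h by (simp add: conj_def M.inv_solve_right)
qed (use g h in \<open>auto simp: act_hom M.conj_hom_self\<close>)

section \<open>The boundary map and the crossed module identities\<close>

lemma bd_closed [simp]: "m \<in> carrier M \<Longrightarrow> bd m \<in> carrier G"
  using bd_hom by (auto simp: hom_def)

lemma bd_mult: "m \<in> carrier M \<Longrightarrow> n \<in> carrier M \<Longrightarrow> bd (m \<otimes> n) = bd m \<otimes>\<^bsub>G\<^esub> bd n"
  using bd_hom by (auto simp: hom_def)

lemma bd_group_hom: "group_hom M G bd"
  by (simp add: bd_hom group_hom_def group_hom_axioms_def M.is_group)

lemma bd_one [simp]: "bd \<one> = \<one>\<^bsub>G\<^esub>"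
  using group_hom.hom_one[OF bd_group_hom] .

lemma bd_inv: "m \<in> carrier M \<Longrightarrow> bd (inv m) = inv\<^bsub>G\<^esub> bd m"
  using group_hom.hom_inv[OF bd_group_hom] .

lemma carrier_induct [consumes 1, case_names one wedge mult inv]:
  assumes m: "m \<in> carrier M" and one: "P \<one>"
    and wedge: "\<And>g h. g \<in> carrier G \<Longrightarrow> h \<in> carrier G \<Longrightarrow> P (wedge g h)"
    and mult: "\<And>m n. m \<in> carrier M \<Longrightarrow> n \<in> carrier M \<Longrightarrow> P m \<Longrightarrow> P n \<Longrightarrow> P (m \<otimes> n)"
    and inv: "\<And>m. m \<in> carrier M \<Longrightarrow> P m \<Longrightarrow> P (inv m)"
  shows "P m"
proof -
  have "m \<in> generate M {wedge g h | g h. g \<in> carrier G \<and> h \<in> carrier G}"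
    using m carrier_generate by simp
  then show ?thesis
  proof (induction rule: generate.induct)
    case (eng m n)
    then show ?case using mult carrier_generate by blast
  qed (auto intro: one wedge inv)
qed

text \<open>The Peiffer identity in general. Both sides turn a product in \<open>m\<close> into a
  composition, and the action of \<open>bd m\<close> is invertible, so the case of generators
  suffices.\<close>

lemma act_bd:
  assumes m: "m \<in> carrier M" and n: "n \<in> carrier M"
  shows "act (bd m) n = conj M m n"
proof -
  have "\<forall>n\<in>carrier M. act (bd m) n = conj M m n"
    using m
  proof (induction rule: carrier_induct)
    case (wedge g h)
    then show ?case by (simp add: bd_wedge act_commutator_wedge)
  next
    case (mult m n)
    then show ?case by (simp add: bd_mult act_act M.conj_mult_left)
  next
    case (inv m)
    show ?case
    proof
      fix n assume n: "n \<in> carrier M"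
      then have "act (bd m) (conj M (inv m) n) = n"
        using inv by simp
      moreover have "act (inv\<^bsub>G\<^esub> bd m) (act (bd m) (conj M (inv m) n)) = conj M (inv m) n"
        using inv n by (intro act_inv_left) simp_all
      ultimately show "act (bd (inv m)) n = conj M (inv m) n"
        using inv by (simp only: bd_inv)
    qed
  qed simp
  then show ?thesis using n by blast
qed

text \<open>As \<open>x g\<close> is \<open>g\<close> times the conjugate of \<open>x\<close> by
  \<open>inv g\<close>, \<open>wedge (x g) h\<close> has two expansions. Splitting
  \<open>conj G g h\<close> as the commutator times \<open>h\<close> isolates the wanted term; the
  Peiffer identity absorbs the conjugation that appears.\<close>

lemma wedge_commutator:
  assumes x: "x \<in> carrier G" and g: "g \<in> carrier G" and h: "h \<in> carrier G"
  shows "wedge x (commutator G g h) = act x (wedge g h) \<otimes> inv wedge g h"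
proof -
  have "wedge x (conj G g h) \<otimes> wedge g h = wedge (conj G g (conj G (inv\<^bsub>G\<^esub> g) x)) (conj G g h) \<otimes> wedge g h"
    using x g by simp
  also have "\<dots> = wedge (g \<otimes>\<^bsub>G\<^esub> conj G (inv\<^bsub>G\<^esub> g) x) h"
    using x g h by (simp add: wedge_mult_left_conj del: G.conj_inv_cancel)
  also have "g \<otimes>\<^bsub>G\<^esub> conj G (inv\<^bsub>G\<^esub> g) x = x \<otimes>\<^bsub>G\<^esub> g"
    using x g by (simp add: conj_def G.m_assoc)
  also have "wedge (x \<otimes>\<^bsub>G\<^esub> g) h = act x (wedge g h) \<otimes> wedge x h"
    using x g h by (simp add: wedge_mult_left)
  finally have 1: "wedge x (conj G g h) \<otimes> wedge g h = act x (wedge g h) \<otimes> wedge x h" .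
  have "conj G g h = commutator G g h \<otimes>\<^bsub>G\<^esub> h"
    using g h by (simp add: conj_def commutator_def G.m_assoc)
  then have "wedge x (conj G g h) = wedge x (commutator G g h) \<otimes> conj M (wedge g h) (wedge x h)"
    using x g h by (simp add: wedge_mult_right act_commutator_wedge)
  then have "wedge x (commutator G g h) \<otimes> wedge g h \<otimes> wedge x h = act x (wedge g h) \<otimes> wedge x h"
    using 1 x g h by (simp add: conj_def M.m_assoc)
  then have "wedge x (commutator G g h) \<otimes> wedge g h = act x (wedge g h)"
    using x g h by (subst (asm) M.r_cancel) auto
  then show ?thesis
    using x g h by (simp add: M.inv_solve_right)
qed

text \<open>Induction from \<open>wedge_commutator\<close>. It turns knowledge about
  \<open>bd m\<close> in the lower central series into knowledge about how \<open>x\<close> moves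
  \<open>m\<close>.\<close>

lemma wedge_bd:
  assumes m: "m \<in> carrier M" and x: "x \<in> carrier G"
  shows "wedge x (bd m) = act x m \<otimes> inv m"
  using m
proof (induction rule: carrier_induct)
  case (wedge g h)
  then show ?case using x by (simp add: bd_wedge wedge_commutator)
next
  case (mult m n)
  then show ?case using x
    by (simp add: bd_mult wedge_mult_right act_bd conj_def act_mult M.m_assoc M.inv_mult_group)
next
  case (inv m)
  have "\<one> = wedge x (bd m \<otimes>\<^bsub>G\<^esub> bd (inv m))"
    using inv x by (simp add: bd_inv)
  also have "\<dots> = wedge x (bd m) \<otimes> conj M m (wedge x (bd (inv m)))"
    using inv x by (simp add: wedge_mult_right act_bd)
  also have "\<dots> = act x m \<otimes> wedge x (bd (inv m)) \<otimes> inv m"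
    using inv x by (simp add: conj_def M.m_assoc)
  finally have "m = act x m \<otimes> wedge x (bd (inv m))"
    using inv x by (metis M.inv_closed M.inv_equality M.inv_inv M.m_closed act_closed bd_closed wedge_closed)
  then have "wedge x (bd (inv m)) = inv act x m \<otimes> m"
    using inv x by (metis M.inv_solve_left act_closed bd_closed wedge_closed M.inv_closed)
  then show ?case using inv x by (simp add: act_inv)
qed (use x in simp)

end

section \<open>The filtration induced by the lower central series\<close>

context group
begin

lemma lcs_closed: "g \<in> lcs G k \<Longrightarrow> g \<in> carrier G"
proof (induction k arbitrary: g)
  case (Suc k)
  have "generate G {commutator G g h | g h. g \<in> lcs G k \<and> h \<in> carrier G} \<subseteq> carrier G"
    using Suc.IH by (intro generate_incl) auto
  then show ?case using Suc.prems by auto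
qed simp

lemma lcs_subgroup: "subgroup (lcs G k) G"
proof (cases k)
  case 0
  then show ?thesis by (simp add: subgroup_self)
next
  case (Suc l)
  then show ?thesis by (auto intro!: generate_is_subgroup simp: lcs_closed)
qed

lemma lcs_commutator: "g \<in> lcs G k \<Longrightarrow> h \<in> carrier G \<Longrightarrow> commutator G g h \<in> lcs G (Suc k)"
  by (auto intro: generate.incl)

lemma conj_generate:
  assumes x: "x \<in> carrier G" and S: "S \<subseteq> carrier G"
    and conj: "\<And>s. s \<in> S \<Longrightarrow> conj G x s \<in> generate G S" and g: "g \<in> generate G S"
  shows "conj G x g \<in> generate G S"
  using g
proof (induction rule: generate.induct)
  case one
  then show ?case using x by (simp add: conj_def generate.one)
next
  case (incl h)
  then show ?case by (rule conj)
next
  case (inv h)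
  then have "conj G x (inv h) = inv conj G x h"
    using x S by (auto simp: conj_def inv_mult_group m_assoc subset_iff)
  then show ?case
    using inv conj generate_m_inv_closed[OF S] by simp
next
  case (eng h1 h2)
  then have "h1 \<in> carrier G" "h2 \<in> carrier G"
    using S generate_in_carrier by auto
  then show ?case
    using eng x by (simp add: conj_mult generate.eng)
qed

lemma lcs_conj: "x \<in> carrier G \<Longrightarrow> g \<in> lcs G k \<Longrightarrow> conj G x g \<in> lcs G k"
proof (induction k arbitrary: g)
  case (Suc k)
  have 1: "conj G x s \<in> generate G {commutator G g h | g h. g \<in> lcs G k \<and> h \<in> carrier G}"
    if "s \<in> {commutator G g h | g h. g \<in> lcs G k \<and> h \<in> carrier G}" for s
  proof -
    obtain g h where s: "s = commutator G g h" "g \<in> lcs G k" "h \<in> carrier G"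
      using \<open>s \<in> _\<close> by blast
    then have "conj G x s = commutator G (conj G x g) (conj G x h)"
      using Suc.prems by (simp add: conj_commutator lcs_closed)
    moreover have "conj G x g \<in> lcs G k" "conj G x h \<in> carrier G"
      using s Suc by simp_all
    ultimately show ?thesis
      by (intro generate.incl) blast
  qed
  have 2: "{commutator G g h | g h. g \<in> lcs G k \<and> h \<in> carrier G} \<subseteq> carrier G"
    by (auto simp: lcs_closed)
  show ?case
    using conj_generate[OF Suc.prems(1) 2 1] Suc.prems(2) by simp
qed simp

lemma lcs_Suc_subset: "lcs G (Suc k) \<subseteq> lcs G k"
proof -
  interpret L: subgroup "lcs G k" G by (rule lcs_subgroup)
  have "commutator G g h \<in> lcs G k" if "g \<in> lcs G k" "h \<in> carrier G" for g h
  proof -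
    have "commutator G g h = g \<otimes> conj G h (inv g)"
      using that by (simp add: commutator_def conj_def m_assoc lcs_closed)
    then show ?thesis
      using that by (simp add: lcs_conj)
  qed
  then have "{commutator G g h | g h. g \<in> lcs G k \<and> h \<in> carrier G} \<subseteq> lcs G k"
    by blast
  then show ?thesis
    by (simp add: generate_subgroup_incl lcs_subgroup)
qed

lemma lcs_antimono: "k \<le> l \<Longrightarrow> lcs G l \<subseteq> lcs G k"
  by (rule lift_Suc_antimono_le) (rule lcs_Suc_subset)

end

section \<open>The filtration \<open>W\<close> and the difference operators\<close>

context exterior_pairing
begin

definition W :: "nat \<Rightarrow> 'm set"
  where "W k = generate M {wedge g h | g h. g \<in> lcs G k \<and> h \<in> carrier G}"

lemma W_subgroup: "subgroup (W k) M"
  unfolding W_def by (rule M.generate_is_subgroup) (auto simp: G.lcs_closed)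

lemma W_carrier: "m \<in> W k \<Longrightarrow> m \<in> carrier M"
  using subgroup.mem_carrier[OF W_subgroup] .

lemma W_0: "W 0 = carrier M"
  using carrier_generate by (simp add: W_def)

lemma wedge_W: "g \<in> lcs G k \<Longrightarrow> h \<in> carrier G \<Longrightarrow> wedge g h \<in> W k"
  unfolding W_def by (rule generate.incl) blast

lemma W_one [simp]: "\<one> \<in> W k"
  using subgroup.one_closed[OF W_subgroup] .

lemma W_mult: "m \<in> W k \<Longrightarrow> n \<in> W k \<Longrightarrow> m \<otimes> n \<in> W k"
  using subgroup.m_closed[OF W_subgroup] .

lemma W_inv: "m \<in> W k \<Longrightarrow> inv m \<in> W k"
  using subgroup.m_inv_closed[OF W_subgroup] .

lemma W_antimono: "k \<le> l \<Longrightarrow> W l \<subseteq> W k"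
  unfolding W_def using G.lcs_antimono by (intro M.mono_generate) blast

lemma W_le: "m \<in> W l \<Longrightarrow> k \<le> l \<Longrightarrow> m \<in> W k"
  using W_antimono by blast

lemma W_induct [consumes 1, case_names one wedge mult inv]:
  assumes m: "m \<in> W k" and one: "P \<one>"
    and wedge: "\<And>g h. g \<in> lcs G k \<Longrightarrow> h \<in> carrier G \<Longrightarrow> P (wedge g h)"
    and mult: "\<And>m n. m \<in> W k \<Longrightarrow> n \<in> W k \<Longrightarrow> P m \<Longrightarrow> P n \<Longrightarrow> P (m \<otimes> n)"
    and inv: "\<And>m. m \<in> W k \<Longrightarrow> P m \<Longrightarrow> P (inv m)"
  shows "P m"
  using m unfolding W_def
proof (induction rule: generate.induct)
  case (inv h)
  then show ?case using assms(3) assms(5) wedge_W by blast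
next
  case (eng m n)
  then show ?case using mult by (simp add: W_def)
qed (use one wedge in auto)

lemma act_W: "x \<in> carrier G \<Longrightarrow> m \<in> W k \<Longrightarrow> act x m \<in> W k"
proof (rotate_tac, induction rule: W_induct)
  case (wedge g h)
  then show ?case by (simp add: act_wedge G.lcs_closed G.lcs_conj wedge_W)
qed (simp_all add: act_mult act_inv W_carrier W_mult W_inv)

text \<open>Conjugation by \<open>n\<close> is the action of \<open>bd n\<close>, so invariance
  under the action contains normality.\<close>

lemma conj_W: "n \<in> carrier M \<Longrightarrow> m \<in> W k \<Longrightarrow> conj M n m \<in> W k"
  using act_W[of "bd n" m k] by (simp add: act_bd W_carrier)

lemma bd_W: "m \<in> W k \<Longrightarrow> bd m \<in> lcs G (Suc k)"
proof (induction rule: W_induct)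
  case (wedge g h)
  then show ?case by (simp only: bd_wedge G.lcs_closed G.lcs_commutator)
qed (simp_all only: bd_one bd_mult bd_inv W_carrier subgroup.one_closed[OF G.lcs_subgroup]
    subgroup.m_closed[OF G.lcs_subgroup] subgroup.m_inv_closed[OF G.lcs_subgroup])

text \<open>In the semidirect product of M and G this is the commutator of \<open>inv m\<close> and
  \<open>x\<close>. The inverse stands on the left so that \<open>act x m\<close> is
  \<open>m\<close> followed by its difference.\<close>

definition diff :: "'a \<Rightarrow> 'm \<Rightarrow> 'm"
  where "diff x m = inv m \<otimes> act x m"

lemma diff_closed [simp]: "x \<in> carrier G \<Longrightarrow> m \<in> carrier M \<Longrightarrow> diff x m \<in> carrier M"
  by (simp add: diff_def)

lemma act_eq_diff: "x \<in> carrier G \<Longrightarrow> m \<in> carrier M \<Longrightarrow> act x m = m \<otimes> diff x m"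
  by (simp add: diff_def)

lemma diff_one [simp]: "x \<in> carrier G \<Longrightarrow> diff x \<one> = \<one>"
  by (simp add: diff_def)

lemma diff_one_left [simp]: "m \<in> carrier M \<Longrightarrow> diff \<one>\<^bsub>G\<^esub> m = \<one>"
  by (simp add: diff_def)

lemma diff_mult_left:
  "x \<in> carrier G \<Longrightarrow> y \<in> carrier G \<Longrightarrow> m \<in> carrier M \<Longrightarrow>
    diff (x \<otimes>\<^bsub>G\<^esub> y) m = diff x m \<otimes> act x (diff y m)"
  by (simp add: diff_def act_act act_mult act_inv M.m_assoc)

lemma diff_inv_left:
  "x \<in> carrier G \<Longrightarrow> m \<in> carrier M \<Longrightarrow>
    diff (inv\<^bsub>G\<^esub> x) m = inv act (inv\<^bsub>G\<^esub> x) (diff x m)"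
  by (simp add: diff_def act_mult act_inv M.inv_mult_group)

text \<open>Up to conjugation by \<open>inv m\<close>, the difference is
  \<open>wedge x (bd m)\<close>, and \<open>bd m\<close> lies one step deeper in the lower central
  series than the index of \<open>m\<close>.\<close>

lemma diff_W_Suc:
  assumes x: "x \<in> carrier G" and m: "m \<in> W k"
  shows "diff x m \<in> W (Suc k)"
proof -
  have [simp]: "m \<in> carrier M" using m by (rule W_carrier)
  have "wedge (bd m) x \<in> W (Suc k)"
    using x m by (intro wedge_W bd_W)
  then have "wedge x (bd m) \<in> W (Suc k)"
    using x by (subst wedge_swap) (simp_all add: W_inv)
  then have "conj M (inv m) (act x m \<otimes> inv m) \<in> W (Suc k)"
    using x by (intro conj_W) (simp_all add: wedge_bd)
  then show ?thesis
    using x by (simp add: diff_def conj_def M.m_assoc)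
qed

text \<open>A three subgroups argument by induction on \<open>j\<close>. The elements
  \<open>x\<close> that raise every \<open>W k\<close> by the required amount form a subgroup, so it
  is enough to treat a commutator \<open>c\<close> of \<open>g\<close> and \<open>h\<close>. Its
  difference is then a product of three factors, each of which combines a difference by
  \<open>g\<close> with a further one.\<close>

lemma diff_W:
  assumes "x \<in> lcs G j" "m \<in> W k"
  shows "diff x m \<in> W (k + j + 1)"
  using assms
proof (induction j arbitrary: x m k)
  case 0
  then show ?case by (simp add: diff_W_Suc)
next
  case (Suc j)
  define S where "S = {x \<in> carrier G. \<forall>k. \<forall>m\<in>W k. diff x m \<in> W (k + Suc j + 1)}"
  have "subgroup S G"
    by (rule G.subgroupI)
      (auto simp: S_def diff_inv_left diff_mult_left W_carrier W_mult W_inv act_W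
        intro!: exI[of _ "\<one>\<^bsub>G\<^esub>"])
  moreover have "c \<in> S" if "c \<in> {commutator G g h | g h. g \<in> lcs G j \<and> h \<in> carrier G}" for c
  proof -
    obtain g h where c: "c = commutator G g h" and g: "g \<in> lcs G j" and h: "h \<in> carrier G"
      using \<open>c \<in> _\<close> by blast
    note [simp] = G.lcs_closed[OF g] h
    have "diff c n \<in> W (k + Suc j + 1)" if n: "n \<in> W k" for k n
    proof -
      \<comment> \<open>Since \<open>c h g\<close> equals \<open>g h\<close>, writing
        \<open>n\<close> as \<open>act (h g) m\<close> gives \<open>act c n\<close> as
        \<open>act g (act h m)\<close>, without any inverse.\<close>
      define m where "m = act (inv\<^bsub>G\<^esub> (h \<otimes>\<^bsub>G\<^esub> g)) n"
      have m: "m \<in> W k" using n by (simp add: m_def act_W)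
      have nm: "n = act (h \<otimes>\<^bsub>G\<^esub> g) m" using n by (simp add: m_def W_carrier)
      note [simp] = W_carrier[OF m]
      define a b where "a = diff g m" and "b = diff h m"
      have a: "a \<in> W (k + j + 1)" using Suc.IH[OF g m] by (simp add: a_def)
      have b: "b \<in> W (k + 1)" using diff_W_Suc[OF h m] by (simp add: b_def)
      note [simp] = W_carrier[OF a] W_carrier[OF b]
      have n': "n = m \<otimes> (b \<otimes> (a \<otimes> diff h a))"
        by (simp add: nm act_act act_eq_diff[of g m] act_mult M.m_assoc flip: a_def)
          (simp add: act_eq_diff M.m_assoc flip: b_def)
      have "act c n = act (c \<otimes>\<^bsub>G\<^esub> (h \<otimes>\<^bsub>G\<^esub> g)) m"
        by (simp add: c nm act_act)
      also have "\<dots> = act g (act h m)"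
        by (simp add: c G.commutator_mult_swap act_act)
      also have "\<dots> = m \<otimes> (a \<otimes> (b \<otimes> diff g b))"
        by (simp add: act_eq_diff[of h m] act_mult M.m_assoc flip: b_def)
          (simp add: act_eq_diff M.m_assoc flip: a_def)
      finally have "diff c n = inv diff h a \<otimes> diff (bd (inv b)) a \<otimes> diff g b"
        by (simp add: diff_def[of c] n')
          (simp add: M.inv_mult_group M.m_assoc diff_def act_bd conj_def)
      moreover have "diff h a \<in> W (k + Suc j + 1)" "diff (bd (inv b)) a \<in> W (k + Suc j + 1)"
        using diff_W_Suc[OF h a] diff_W_Suc[OF _ a, of "bd (inv b)"] by simp_all
      moreover have "diff g b \<in> W (k + Suc j + 1)"
        using Suc.IH[OF g b] by simp
      ultimately show ?thesis by (simp add: W_mult W_inv)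
    qed
    then show ?thesis by (simp add: c S_def)
  qed
  ultimately have "generate G {commutator G g h | g h. g \<in> lcs G j \<and> h \<in> carrier G} \<subseteq> S"
    by (intro G.generate_subgroup_incl) auto
  then have "x \<in> S" using Suc.prems(1) by auto
  then show ?case using Suc.prems(2) by (simp add: S_def)
qed

text \<open>By the Peiffer identity \<open>diff (bd n) m\<close> is the commutator of
  \<open>inv m\<close> and \<open>n\<close>, so this bounds the commutator of two filtration terms.
  The 2 arises as one step from \<open>bd\<close> and one from \<open>diff_W\<close>.\<close>

lemma W_commutator:
  assumes m: "m \<in> W k" and n: "n \<in> W l"
  shows "diff (bd n) m \<in> W (k + l + 2)"
  using diff_W[OF bd_W[OF n] m] by simp

end

section \<open>Twisted powers\<close>

lemma choose_Suc_numerals: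
  "Suc n choose 2 = n + (n choose 2)" "Suc n choose 3 = (n choose 2) + (n choose 3)"
  "Suc n choose 4 = (n choose 3) + (n choose 4)" "Suc n choose 5 = (n choose 4) + (n choose 5)"
  by (simp_all add: eval_nat_numeral)

context group
begin

text \<open>Centralizers are subgroups, and this is used twice: S centralizes itself, so the
  subgroup it generates centralizes S; hence S, and then the generated subgroup, centralizes the
  generated subgroup.\<close>

lemma generate_commute:
  assumes S: "S \<subseteq> carrier G" and comm: "\<And>a b. a \<in> S \<Longrightarrow> b \<in> S \<Longrightarrow> a \<otimes> b = b \<otimes> a"
    and a: "a \<in> generate G S" and b: "b \<in> generate G S"
  shows "a \<otimes> b = b \<otimes> a"
proof -
  have centralizer: "subgroup {x \<in> carrier G. \<forall>y\<in>Y. x \<otimes> y = y \<otimes> x} G" if "Y \<subseteq> carrier G" for Y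
  proof (rule subgroupI)
    fix x assume x: "x \<in> {x \<in> carrier G. \<forall>y\<in>Y. x \<otimes> y = y \<otimes> x}"
    have "inv x \<otimes> y = y \<otimes> inv x" if "y \<in> Y" for y
    proof -
      have y: "y \<in> carrier G" "x \<otimes> y = y \<otimes> x" using \<open>Y \<subseteq> carrier G\<close> x that by auto
      have "x \<otimes> (y \<otimes> inv x) = y \<otimes> x \<otimes> inv x"
        using x y by (simp flip: m_assoc)
      also have "\<dots> = y"
        using x y(1) by (simp add: m_assoc)
      finally have "inv x \<otimes> y = inv x \<otimes> (x \<otimes> (y \<otimes> inv x))"
        by simp
      then show ?thesis using x y(1) by simp
    qed
    then show "inv x \<in> {x \<in> carrier G. \<forall>y\<in>Y. x \<otimes> y = y \<otimes> x}" using x by simp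
  next
    fix x x' assume x: "x \<in> {x \<in> carrier G. \<forall>y\<in>Y. x \<otimes> y = y \<otimes> x}"
      and x': "x' \<in> {x \<in> carrier G. \<forall>y\<in>Y. x \<otimes> y = y \<otimes> x}"
    have "x \<otimes> x' \<otimes> y = y \<otimes> (x \<otimes> x')" if "y \<in> Y" for y
    proof -
      have y: "y \<in> carrier G" "x \<otimes> y = y \<otimes> x" "x' \<otimes> y = y \<otimes> x'"
        using \<open>Y \<subseteq> carrier G\<close> x x' that by auto
      have "x \<otimes> x' \<otimes> y = x \<otimes> y \<otimes> x'"
        using x x' y(1,3) by (simp add: m_assoc)
      also have "\<dots> = y \<otimes> (x \<otimes> x')"
        using x x' y(1,2) by (simp add: m_assoc)
      finally show ?thesis .
    qed
    then show "x \<otimes> x' \<in> {x \<in> carrier G. \<forall>y\<in>Y. x \<otimes> y = y \<otimes> x}" using x x' by simp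
  qed (use that in \<open>auto intro!: exI[of _ \<one>]\<close>)
  have 1: "generate G S \<subseteq> {x \<in> carrier G. \<forall>y\<in>S. x \<otimes> y = y \<otimes> x}"
    by (rule generate_subgroup_incl[OF _ centralizer[OF S]]) (use S comm in auto)
  then have "y \<otimes> s = s \<otimes> y" if "s \<in> S" "y \<in> generate G S" for s y
    using that by blast
  then have "S \<subseteq> {x \<in> carrier G. \<forall>y\<in>generate G S. x \<otimes> y = y \<otimes> x}"
    using S by auto
  then have 2: "generate G S \<subseteq> {x \<in> carrier G. \<forall>y\<in>generate G S. x \<otimes> y = y \<otimes> x}"
    using S by (intro generate_subgroup_incl centralizer generate_incl)
  then show ?thesis using a b by blast
qed

text \<open>\<open>T n\<close> is the product of the first \<open>n\<close> elements of the sequence \<open>c, \<phi> c, \<phi> (\<phi> c), \<dots>\<close>;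
  for \<open>\<phi>\<close> conjugation by \<open>a\<close> it equals \<open>(c a)\<^sup>n a\<^sup>-\<^sup>n\<close>.\<close>
lemma twisted_power:
  assumes hom: "\<phi> \<in> hom G G"
    and A: "subgroup A G" and comm: "\<And>a b. a \<in> A \<Longrightarrow> b \<in> A \<Longrightarrow> a \<otimes> b = b \<otimes> a"
    and mem: "d1 \<in> A" "d2 \<in> A" "d3 \<in> A" "d4 \<in> A" "u \<in> A" "v \<in> A" and c: "c \<in> carrier G"
    and phi: "\<phi> c = c \<otimes> d1" "\<phi> d1 = d1 \<otimes> d2" "\<phi> d2 = d2 \<otimes> d3" "\<phi> d3 = d3 \<otimes> d4" "\<phi> d4 = d4"
      "\<phi> u = u \<otimes> v" "\<phi> v = v"
    and d1c: "d1 \<otimes> c = c \<otimes> (d1 \<otimes> u)" and uc: "u \<otimes> c = c \<otimes> u"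
    and T0: "T 0 = \<one>" and T: "\<And>n. T (Suc n) = c \<otimes> \<phi> (T n)"
  shows "T n = c [^] n \<otimes> (d1 [^] (n choose 2) \<otimes> (d2 [^] (n choose 3) \<otimes> (d3 [^] (n choose 4)
      \<otimes> (d4 [^] (n choose 5) \<otimes> (u [^] (n choose 3) \<otimes> v [^] (n choose 4))))))"
proof -
  interpret A: subgroup A G by (rule A)
  interpret phi: group_hom G G \<phi>
    using hom by (simp add: group_hom_def group_hom_axioms_def is_group)
  note [simp] = c mem A.mem_carrier
  have pow_mem [simp]: "a [^] (k::nat) \<in> A" if "a \<in> A" for a k
    by (induction k) (use that in auto)
  have lcomm: "a \<otimes> (b \<otimes> x) = b \<otimes> (a \<otimes> x)" if "a \<in> A" "b \<in> A" "x \<in> A" for a b x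
    using that comm[of a b] by (simp flip: m_assoc)
  have distrib: "(a \<otimes> b) [^] (k::nat) = a [^] k \<otimes> b [^] k" if "a \<in> A" "b \<in> A" for a b k
    using that comm by (intro pow_mult_distrib) auto
  have upow: "u [^] k \<otimes> c = c \<otimes> u [^] k" for k :: nat
    by (induction k) (simp_all add: m_assoc uc, simp flip: m_assoc)
  have d1pow: "d1 [^] k \<otimes> c = c \<otimes> (d1 [^] k \<otimes> u [^] k)" for k :: nat
  proof (induction k)
    case (Suc k)
    have "d1 [^] Suc k \<otimes> c = (d1 [^] k \<otimes> c) \<otimes> (d1 \<otimes> u)"
      by (simp add: m_assoc d1c)
    then show ?case
      by (simp add: Suc m_assoc) (simp add: m_assoc comm lcomm)
  qed simp
  \<comment> \<open>Collection from the left: moving \<open>c\<close> past \<open>d1 [^] k\<close>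
    costs \<open>u [^] k\<close>, and the sum of these exponents is
    \<open>k choose 2\<close>.\<close>
  have cd1: "(c \<otimes> d1) [^] k = c [^] k \<otimes> (d1 [^] k \<otimes> u [^] (k choose 2))" for k :: nat
  proof (induction k)
    case (Suc k)
    have "(c \<otimes> d1) [^] Suc k = c [^] k \<otimes> (d1 [^] k \<otimes> (u [^] (k choose 2) \<otimes> c)) \<otimes> d1"
      by (simp add: Suc m_assoc)
    also have "\<dots> = c [^] k \<otimes> ((d1 [^] k \<otimes> c) \<otimes> (u [^] (k choose 2) \<otimes> d1))"
      by (simp add: upow m_assoc)
    also have "\<dots> = c [^] Suc k \<otimes> (d1 [^] k \<otimes> (u [^] k \<otimes> (u [^] (k choose 2) \<otimes> d1)))"
      by (simp add: d1pow m_assoc)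
    also have "\<dots> = c [^] Suc k \<otimes> (d1 [^] Suc k \<otimes> u [^] (Suc k choose 2))"
      by (simp add: choose_Suc_numerals nat_pow_mult[symmetric] m_assoc comm lcomm)
    finally show ?case .
  qed (simp add: numeral_2_eq_2)
  show ?thesis
  proof (induction n)
    case 0
    show ?case by (simp add: T0 eval_nat_numeral)
  next
    case (Suc n)
    show ?case
      \<comment> \<open>Applying \<phi> adds to each exponent the previous one in its chain, while
        \<open>cd1\<close> supplies the exponent \<open>n\<close> of \<open>d1\<close> and
        \<open>n choose 2\<close> of \<open>u\<close>. Pascal's rule does the rest.\<close>
      by (simp only: nat_pow_Suc2 c)
        (simp add: T Suc phi phi.hom_nat_pow cd1 distrib choose_Suc_numerals
          nat_pow_mult[symmetric] m_assoc comm lcomm)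
  qed
qed

end

context group
begin

lemma pow_eq_one_dvd: "x \<in> carrier G \<Longrightarrow> x [^] (n::nat) = \<one> \<Longrightarrow> n dvd m \<Longrightarrow> x [^] m = \<one>"
  by (auto simp: nat_pow_pow[symmetric] elim!: dvdE)

end

section \<open>Class five\<close>

text \<open>The prime is encoded in \<open>q_dvd\<close>. For a power \<open>q\<close> of 5,
  \<open>q choose 5\<close> is the first binomial coefficient of positive index that
  \<open>q\<close> need not divide, and it misses at most a factor 5.\<close>

locale exterior_pairing_class5 = exterior_pairing +
  fixes q :: nat
  assumes lcs_5: "lcs G 5 = {\<one>\<^bsub>G\<^esub>}"
    and pow_q: "x \<in> carrier G \<Longrightarrow> x [^]\<^bsub>G\<^esub> q = \<one>\<^bsub>G\<^esub>"
    and q_dvd: "q dvd q choose 2" "q dvd q choose 3" "q dvd q choose 4" "q dvd 5 * (q choose 5)"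
begin

lemma W_trivial: "m \<in> W k \<Longrightarrow> 5 \<le> k \<Longrightarrow> m = \<one>"
proof -
  have "m = \<one>" if "m \<in> W 5" for m
    using that by (induction rule: W_induct) (auto simp: lcs_5)
  then show "m \<in> W k \<Longrightarrow> 5 \<le> k \<Longrightarrow> m = \<one>"
    using W_le by blast
qed

text \<open>The commutator lies in \<open>W (k + l + 2)\<close>, which is trivial from index 5
  on.\<close>

lemma W_commute:
  assumes m: "m \<in> W k" and n: "n \<in> W l" and "3 \<le> k + l"
  shows "m \<otimes> n = n \<otimes> m"
proof -
  have [simp]: "m \<in> carrier M" "n \<in> carrier M" using m n W_carrier by auto
  have "diff (bd n) m = \<one>"
    using W_commutator[OF m n] assms(3) by (intro W_trivial) auto
  then have "conj M n m = m"
    using act_eq_diff[of "bd n" m] by (simp add: act_bd)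
  then have "conj M n m \<otimes> n = m \<otimes> n"
    by simp
  then show ?thesis
    by (simp add: conj_def M.m_assoc)
qed

section \<open>Multilinearity of iterated differences\<close>

lemma fold_diff_W:
  "set xs \<subseteq> carrier G \<Longrightarrow> m \<in> W k \<Longrightarrow> fold diff xs m \<in> W (k + length xs)"
proof (induction xs arbitrary: m k)
  case (Cons x xs)
  then show ?case using Cons.IH[of "diff x m" "Suc k"] by (simp add: diff_W_Suc)
qed simp

text \<open>The middle factor measures how far \<open>diff x\<close> is from a homomorphism: it is
  the price of moving \<open>diff x m\<close> past \<open>n\<close>.\<close>

lemma diff_mult_commutator:
  assumes "x \<in> carrier G" "m \<in> carrier M" "n \<in> carrier M"
  shows "diff x (m \<otimes> n) = diff x m \<otimes> (diff (bd (inv n)) (diff x m) \<otimes> diff x n)"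
  using assms by (simp add: diff_def[of "bd (inv n)"] act_bd)
    (simp add: diff_def conj_def act_mult M.inv_mult_group M.m_assoc)

text \<open>The correction has depth at least \<open>2 k + 3\<close>, which reaches 5 exactly when
  \<open>k\<close> is at least 1.\<close>

lemma diff_mult:
  assumes "x \<in> carrier G" "m \<in> W k" "n \<in> W k" "1 \<le> k"
  shows "diff x (m \<otimes> n) = diff x m \<otimes> diff x n"
proof -
  have "diff (bd (inv n)) (diff x m) \<in> W (Suc k + k + 2)"
    using assms by (intro W_commutator diff_W_Suc W_inv)
  then have "diff (bd (inv n)) (diff x m) = \<one>"
    using assms(4) by (intro W_trivial) auto
  then show ?thesis
    using assms by (simp add: diff_mult_commutator W_carrier)
qed

lemma fold_diff_mult:
  "set xs \<subseteq> carrier G \<Longrightarrow> m \<in> W k \<Longrightarrow> n \<in> W k \<Longrightarrow> 1 \<le> k \<Longrightarrow>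
    fold diff xs (m \<otimes> n) = fold diff xs m \<otimes> fold diff xs n"
proof (induction xs arbitrary: m n k)
  case (Cons x xs)
  then show ?case
    using Cons.IH[of "diff x m" "Suc k" "diff x n"] by (simp add: diff_W_Suc diff_mult)
qed simp

lemma fold_diff_trivial:
  "set xs \<subseteq> carrier G \<Longrightarrow> m \<in> W k \<Longrightarrow> 5 \<le> k + length xs \<Longrightarrow> fold diff xs m = \<one>"
  using fold_diff_W W_trivial by blast

text \<open>The only obstacle to additivity in the group element is
  \<open>diff g (diff h m)\<close>. It lies in \<open>W (k + 2)\<close>, and the remaining
  differences push it to depth 5.\<close>

lemma fold_diff_diff_mult:
  assumes xs: "set xs \<subseteq> carrier G" and g: "g \<in> carrier G" and h: "h \<in> carrier G"
    and m: "m \<in> W k" and "3 \<le> k + length xs"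
  shows "fold diff xs (diff (g \<otimes>\<^bsub>G\<^esub> h) m) = fold diff xs (diff g m) \<otimes> fold diff xs (diff h m)"
proof -
  have W: "diff g m \<in> W (Suc k)" "diff h m \<in> W (Suc k)" "diff g (diff h m) \<in> W (Suc (Suc k))"
    using g h m by (simp_all add: diff_W_Suc)
  have "diff (g \<otimes>\<^bsub>G\<^esub> h) m = diff g m \<otimes> (diff h m \<otimes> diff g (diff h m))"
    using g h m by (simp add: diff_mult_left act_eq_diff W_carrier)
  moreover have "fold diff xs (diff g (diff h m)) = \<one>"
    using xs W(3) assms(5) by (intro fold_diff_trivial) auto
  moreover have "fold diff xs (diff h m) \<in> carrier M"
    using fold_diff_W[OF xs W(2)] W_carrier by blast
  ultimately show ?thesis
    using xs W W_le[OF W(3), of "Suc k"] by (simp add: fold_diff_mult[of xs _ "Suc k"] W_mult)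
qed

lemma fold_diff_diff_pow:
  assumes xs: "set xs \<subseteq> carrier G" and h: "h \<in> carrier G"
    and m: "m \<in> W k" and "3 \<le> k + length xs"
  shows "fold diff xs (diff (h [^]\<^bsub>G\<^esub> (i::nat)) m) = fold diff xs (diff h m) [^] i"
proof (induction i)
  case 0
  then show ?case using fold_diff_trivial[OF xs, of \<one> 5] m by (simp add: W_carrier)
next
  case (Suc i)
  then show ?case using assms by (simp add: fold_diff_diff_mult)
qed

lemma W_4_ac:
  "a \<in> W 4 \<Longrightarrow> b \<in> W 4 \<Longrightarrow> a \<otimes> b = b \<otimes> a"
  "a \<in> W 4 \<Longrightarrow> b \<in> W 4 \<Longrightarrow> x \<in> W 4 \<Longrightarrow> a \<otimes> (b \<otimes> x) = b \<otimes> (a \<otimes> x)"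
proof -
  show *: "a \<in> W 4 \<Longrightarrow> b \<in> W 4 \<Longrightarrow> a \<otimes> b = b \<otimes> a" for a b
    by (rule W_commute) auto
  show "a \<in> W 4 \<Longrightarrow> b \<in> W 4 \<Longrightarrow> x \<in> W 4 \<Longrightarrow> a \<otimes> (b \<otimes> x) = b \<otimes> (a \<otimes> x)"
    using *[of a b] by (simp add: W_carrier flip: M.m_assoc)
qed

lemma W_pow: "m \<in> W k \<Longrightarrow> m [^] (n::nat) \<in> W k"
  by (induction n) (simp_all add: W_mult)

lemma W_4_pow_mult:
  "a \<in> W 4 \<Longrightarrow> b \<in> W 4 \<Longrightarrow> (a \<otimes> b) [^] (n::nat) = a [^] n \<otimes> b [^] n"
  by (intro M.pow_mult_distrib W_4_ac W_carrier)

text \<open>Polynomial dependence on \<open>i\<close>, written multiplicatively in the abelian group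
  \<open>W 4\<close>. All five coefficients are kept for every degree \<open>j\<close>, those above
  \<open>j\<close> being trivial. In the induction the outermost difference by
  \<open>x y ^ i\<close> splits into one by \<open>x\<close> and the \<open>i\<close>-th power of
  one by \<open>y\<close>.\<close>

lemma fold_diff_polynomial:
  assumes x: "x \<in> carrier G" and y: "y \<in> carrier G" and m: "m \<in> W (4 - j)" and "j \<le> 4"
  shows "\<exists>A. (\<forall>l. A l \<in> W 4) \<and> (\<forall>l>j. A l = \<one>) \<and> A j = fold diff (replicate j y) m \<and>
    (\<forall>i::nat. fold diff (replicate j (x \<otimes>\<^bsub>G\<^esub> y [^]\<^bsub>G\<^esub> i)) m =
      A 0 \<otimes> (A 1 [^] i \<otimes> (A 2 [^] i\<^sup>2 \<otimes> (A 3 [^] i ^ 3 \<otimes> A 4 [^] i ^ 4))))"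
  using m \<open>j \<le> 4\<close>
proof (induction j arbitrary: m)
  case 0
  then show ?case
    by (intro exI[of _ "\<lambda>l. if l = 0 then m else \<one>"]) (auto simp: W_carrier)
next
  case (Suc j)
  have dW: "diff x m \<in> W (4 - j)" "diff y m \<in> W (4 - j)"
    using diff_W_Suc[OF x Suc.prems(1)] diff_W_Suc[OF y Suc.prems(1)] Suc.prems(2)
    by (simp_all add: Suc_diff_le[symmetric])
  have j4: "j \<le> 4" using Suc.prems by simp
  obtain A where A: "\<And>l. A l \<in> W 4" "\<And>l. j < l \<Longrightarrow> A l = \<one>" and
    Ai: "\<And>i::nat. fold diff (replicate j (x \<otimes>\<^bsub>G\<^esub> y [^]\<^bsub>G\<^esub> i)) (diff x m) =
      A 0 \<otimes> (A 1 [^] i \<otimes> (A 2 [^] i\<^sup>2 \<otimes> (A 3 [^] i ^ 3 \<otimes> A 4 [^] i ^ 4)))"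
    using Suc.IH[OF dW(1) j4] by blast
  obtain B where B: "\<And>l. B l \<in> W 4" "\<And>l. j < l \<Longrightarrow> B l = \<one>"
      "B j = fold diff (replicate j y) (diff y m)" and
    Bi: "\<And>i::nat. fold diff (replicate j (x \<otimes>\<^bsub>G\<^esub> y [^]\<^bsub>G\<^esub> i)) (diff y m) =
      B 0 \<otimes> (B 1 [^] i \<otimes> (B 2 [^] i\<^sup>2 \<otimes> (B 3 [^] i ^ 3 \<otimes> B 4 [^] i ^ 4)))"
    using Suc.IH[OF dW(2) j4] by blast
  note [simp] = A(1) B(1) A(1)[THEN W_carrier] B(1)[THEN W_carrier]
  \<comment> \<open>\<open>B\<close> has degree at most 3 here, so multiplying its polynomial by
    \<open>i\<close> does not leave the range of the five coefficients.\<close>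
  have B4: "B 4 = \<one>" using Suc.prems by (intro B(2)) auto
  \<comment> \<open>The coefficients of the polynomial of \<open>A\<close> plus \<open>i\<close>
    times that of \<open>B\<close>.\<close>
  define C where "C l = (if l = 0 then A 0 else A l \<otimes> B (l - 1))" for l
  have C: "C 0 = A 0" "C 1 = A 1 \<otimes> B 0" "C 2 = A 2 \<otimes> B 1" "C 3 = A 3 \<otimes> B 2"
      "C 4 = A 4 \<otimes> B 3"
    by (simp_all add: C_def)
  have "fold diff (replicate (Suc j) (x \<otimes>\<^bsub>G\<^esub> y [^]\<^bsub>G\<^esub> i)) m =
      C 0 \<otimes> (C 1 [^] i \<otimes> (C 2 [^] i\<^sup>2 \<otimes> (C 3 [^] i ^ 3 \<otimes> C 4 [^] i ^ 4)))" for i :: nat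
  proof -
    have pow_i: "i * i = i\<^sup>2" "i\<^sup>2 * i = i ^ 3" "i ^ 3 * i = i ^ 4"
      by (simp_all add: eval_nat_numeral)
    have sub: "set (replicate j (x \<otimes>\<^bsub>G\<^esub> y [^]\<^bsub>G\<^esub> i)) \<subseteq> carrier G"
      using x y by auto
    have 1: "fold diff (replicate j (x \<otimes>\<^bsub>G\<^esub> y [^]\<^bsub>G\<^esub> i)) (diff (x \<otimes>\<^bsub>G\<^esub> y [^]\<^bsub>G\<^esub> i) m) =
        fold diff (replicate j (x \<otimes>\<^bsub>G\<^esub> y [^]\<^bsub>G\<^esub> i)) (diff x m) \<otimes>
        fold diff (replicate j (x \<otimes>\<^bsub>G\<^esub> y [^]\<^bsub>G\<^esub> i)) (diff (y [^]\<^bsub>G\<^esub> i) m)"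
      by (rule fold_diff_diff_mult[OF sub x _ Suc.prems(1)]) (use y Suc.prems(2) in auto)
    have 2: "fold diff (replicate j (x \<otimes>\<^bsub>G\<^esub> y [^]\<^bsub>G\<^esub> i)) (diff (y [^]\<^bsub>G\<^esub> i) m) =
        fold diff (replicate j (x \<otimes>\<^bsub>G\<^esub> y [^]\<^bsub>G\<^esub> i)) (diff y m) [^] i"
      by (rule fold_diff_diff_pow[OF sub y Suc.prems(1)]) (use Suc.prems(2) in auto)
    have "fold diff (replicate (Suc j) (x \<otimes>\<^bsub>G\<^esub> y [^]\<^bsub>G\<^esub> i)) m =
        fold diff (replicate j (x \<otimes>\<^bsub>G\<^esub> y [^]\<^bsub>G\<^esub> i)) (diff x m) \<otimes>
        fold diff (replicate j (x \<otimes>\<^bsub>G\<^esub> y [^]\<^bsub>G\<^esub> i)) (diff y m) [^] i"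
      unfolding replicate_Suc fold_Cons o_apply 1 2 ..
    also have "\<dots> = C 0 \<otimes> (C 1 [^] i \<otimes> (C 2 [^] i\<^sup>2 \<otimes> (C 3 [^] i ^ 3 \<otimes> C 4 [^] i ^ 4)))"
      unfolding Ai Bi B4 C
      by (simp add: W_4_pow_mult W_pow W_mult M.nat_pow_pow M.m_assoc W_4_ac W_carrier pow_i)
    finally show ?thesis .
  qed
  moreover have "C (Suc j) = fold diff (replicate (Suc j) y) m"
    unfolding replicate_Suc fold_Cons o_apply B(3)[symmetric]
    using A(2)[of "Suc j"] by (simp add: C_def)
  moreover have "\<forall>l. C l \<in> W 4" "\<forall>l>Suc j. C l = \<one>"
    using A(2) B(2) by (auto simp: C_def W_mult)
  ultimately show ?case by blast
qed

section \<open>Exponents of the filtration terms, from \<open>W (Suc k)\<close> up to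
  \<open>W k\<close>\<close>

context
  fixes k :: nat
  assumes exp_Suc: "\<And>m. m \<in> W (Suc k) \<Longrightarrow> m [^] q = \<one>"
begin

lemma exp_Suc_dvd: "m \<in> W (Suc k) \<Longrightarrow> q dvd n \<Longrightarrow> m [^] n = \<one>"
  using exp_Suc M.pow_eq_one_dvd W_carrier by blast

text \<open>All correction factors of \<open>twisted_power\<close> lie in \<open>W (Suc k)\<close>,
  which has exponent dividing \<open>q\<close>. So those whose binomial exponent is divisible by
  \<open>q\<close> vanish, and only the fourth difference survives.\<close>

lemma twisted_power_q:
  assumes x: "x \<in> carrier G" and c: "c \<in> W k"
    and T0: "T 0 = \<one>" and T: "\<And>n. T (Suc n) = c \<otimes> act x (T n)"
  shows "T q = c [^] q \<otimes> fold diff [x, x, x, x] c [^] (q choose 5)"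
proof -
  define d1 d2 d3 d4 where "d1 = diff x c" and "d2 = diff x d1" and "d3 = diff x d2" and "d4 = diff x d3"
  \<comment> \<open>\<open>u\<close> is the commutator that arises when \<open>d1\<close> moves past
    \<open>c\<close>. It lies in \<open>W 3\<close> even for \<open>k = 0\<close>, hence commutes
    with \<open>c\<close>, and two differences by \<open>x\<close> kill it.\<close>
  define u v where "u = diff (bd (inv c)) d1" and "v = diff x u"
  have d: "d1 \<in> W (Suc k)" "d2 \<in> W (Suc (Suc k))" "d3 \<in> W (Suc (Suc (Suc k)))"
      "d4 \<in> W (Suc (Suc (Suc (Suc k))))"
    using x c by (simp_all add: d1_def d2_def d3_def d4_def diff_W_Suc)
  have cM [simp]: "c \<in> carrier M" using c by (rule W_carrier)
  have d1M [simp]: "d1 \<in> carrier M" using d(1) by (rule W_carrier)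
  have "u \<in> W (Suc k + k + 2)" "u \<in> W (Suc (Suc k))"
    using d(1) c by (simp_all only: u_def W_commutator W_inv diff_W_Suc bd_closed M.inv_closed cM)
  then have u: "u \<in> W 3" "u \<in> W (Suc k)"
    by (auto elim: W_le)
  have v: "v \<in> W 4" "v \<in> W (Suc k)"
    using diff_W_Suc[OF x u(1)] diff_W_Suc[OF x u(2)] by (auto simp: v_def elim: W_le)
  have d2: "d2 \<in> W 2" "d3 \<in> W 2" "d4 \<in> W 2" "u \<in> W 2" "v \<in> W 2"
    using d(2-4) u(1) v(1) by (auto elim: W_le)
  note [simp] = d2[THEN W_carrier]
  \<comment> \<open>\<open>d1\<close> lies in \<open>W 1\<close>, so it commutes with the abelian
    group \<open>W 2\<close>. The element \<open>c\<close> stays outside \<open>A\<close>, as for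
    \<open>k = 0\<close> it may fail to commute with \<open>d1\<close>.\<close>
  define A where "A = generate M (insert d1 (W 2))"
  have Asub: "insert d1 (W 2) \<subseteq> carrier M" using W_carrier by auto
  have "a \<otimes> b = b \<otimes> a" if "a \<in> insert d1 (W 2)" "b \<in> insert d1 (W 2)" for a b
  proof -
    have "d1 \<in> W 1" using d(1) by (rule W_le) simp
    then show ?thesis
      using that W_commute[of a 2 b 2] W_commute[of d1 1 b 2] W_commute[of a 2 d1 1] by auto
  qed
  then have comm: "a \<otimes> b = b \<otimes> a" if "a \<in> A" "b \<in> A" for a b
    using M.generate_commute[OF Asub _ that[unfolded A_def]] by blast
  have mem: "d1 \<in> A" "d2 \<in> A" "d3 \<in> A" "d4 \<in> A" "u \<in> A" "v \<in> A"
    using d2 by (auto simp: A_def intro: generate.incl)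
  have "diff x d4 \<in> W (Suc (Suc (Suc (Suc (Suc k)))))" "diff x v \<in> W 5"
    using diff_W_Suc[OF x d(4)] diff_W_Suc[OF x v(1)] by simp_all
  then have top: "diff x d4 = \<one>" "diff x v = \<one>"
    by (auto intro: W_trivial)
  have phi: "act x c = c \<otimes> d1" "act x d1 = d1 \<otimes> d2" "act x d2 = d2 \<otimes> d3" "act x d3 = d3 \<otimes> d4"
      "act x d4 = d4" "act x u = u \<otimes> v" "act x v = v"
    using x top by (simp_all add: act_eq_diff d1_def[symmetric] d2_def[symmetric] d3_def[symmetric]
      d4_def[symmetric] v_def[symmetric])
  have "d1 \<otimes> u = conj M (inv c) d1"
    by (simp add: u_def flip: act_eq_diff) (simp add: act_bd)
  then have d1c: "d1 \<otimes> c = c \<otimes> (d1 \<otimes> u)"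
    by (simp add: conj_def M.m_assoc)
  have uc: "u \<otimes> c = c \<otimes> u"
    using u(1) c by (intro W_commute) auto
  have "T q = c [^] q \<otimes> (d1 [^] (q choose 2) \<otimes> (d2 [^] (q choose 3) \<otimes> (d3 [^] (q choose 4)
      \<otimes> (d4 [^] (q choose 5) \<otimes> (u [^] (q choose 3) \<otimes> v [^] (q choose 4))))))"
    by (rule M.twisted_power[OF act_hom[OF x] _ comm mem cM phi d1c uc T0 T])
      (simp_all add: A_def M.generate_is_subgroup[OF Asub])
  also have "\<dots> = c [^] q \<otimes> d4 [^] (q choose 5)"
    using d(1) W_le[OF d(2), of "Suc k"] W_le[OF d(3), of "Suc k"] u(2) v(2) q_dvd
    by (simp add: exp_Suc_dvd)
  finally show ?thesis
    by (simp add: d1_def d2_def d3_def d4_def)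
qed

text \<open>\<open>T\<close> is the twisted power of \<open>b\<close> under conjugation by
  \<open>a\<close>, which is the action of \<open>bd a\<close>. As \<open>bd a\<close> lies in the
  derived subgroup, each difference gains two steps, so four of them exceed depth 5.\<close>

lemma mult_pow_q:
  assumes a: "a \<in> W k" and b: "b \<in> W k" and aq: "a [^] q = \<one>" and bq: "b [^] q = \<one>"
  shows "(b \<otimes> a) [^] q = \<one>"
proof -
  have [simp]: "a \<in> carrier M" "b \<in> carrier M" using a b W_carrier by auto
  define T where "T n = (b \<otimes> a) [^] n \<otimes> inv a [^] n" for n :: nat
  have "T q = b [^] q \<otimes> fold diff [bd a, bd a, bd a, bd a] b [^] (q choose 5)"
  proof (rule twisted_power_q)
    show "T (Suc n) = b \<otimes> act (bd a) (T n)" for n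
      unfolding T_def M.nat_pow_Suc2[OF M.m_closed[OF \<open>b \<in> carrier M\<close> \<open>a \<in> carrier M\<close>]]
      by (simp add: act_bd conj_def M.m_assoc M.inv_mult_group)
  qed (use b in \<open>simp_all add: T_def\<close>)
  moreover have "fold diff [bd a, bd a, bd a, bd a] b = \<one>"
  proof -
    have ba: "bd a \<in> lcs G 1" using bd_W[of a 0] by (simp add: W_0)
    have "b \<in> W 0" by (simp add: W_0)
    from diff_W[OF ba diff_W[OF ba diff_W[OF ba diff_W[OF ba this]]]]
    show ?thesis by (simp add: W_trivial)
  qed
  ultimately show ?thesis by (simp add: T_def aq bq M.nat_pow_inv)
qed

lemma exp_W:
  assumes wedge: "\<And>g h. g \<in> lcs G k \<Longrightarrow> h \<in> carrier G \<Longrightarrow> wedge g h [^] q = \<one>"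
    and m: "m \<in> W k"
  shows "m [^] q = \<one>"
  using m
proof (induction rule: W_induct)
  case (mult m n)
  then show ?case using mult_pow_q by blast
next
  case (inv m)
  then show ?case by (simp add: W_carrier M.nat_pow_inv)
qed (simp_all add: wedge)

text \<open>The elements \<open>wedge y (x ^ n)\<close> are the twisted powers of
  \<open>wedge y x\<close> under \<open>x\<close>, and at \<open>n = q\<close> they return to the
  identity.\<close>

lemma wedge_pow_q:
  assumes y: "y \<in> lcs G k" and x: "x \<in> carrier G"
  shows "wedge y x [^] q \<otimes> fold diff [x, x, x, x] (wedge y x) [^] (q choose 5) = \<one>"
proof -
  have [simp]: "y \<in> carrier G" using y by (rule G.lcs_closed)
  have "wedge y (x [^]\<^bsub>G\<^esub> q) = wedge y x [^] q \<otimes> fold diff [x, x, x, x] (wedge y x) [^] (q choose 5)"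
  proof (rule twisted_power_q)
    show "wedge y (x [^]\<^bsub>G\<^esub> Suc n) = wedge y x \<otimes> act x (wedge y (x [^]\<^bsub>G\<^esub> n))" for n
      unfolding G.nat_pow_Suc2[OF x] using x by (simp add: wedge_mult_right)
  qed (use x y in \<open>simp_all add: wedge_W\<close>)
  then show ?thesis using x by (simp add: pow_q)
qed

end

text \<open>Descending induction on \<open>k\<close>, with \<open>5 - k\<close> as measure. A wedge
  in \<open>W (Suc k)\<close> already has depth at least 1, so its fourth difference is trivial and
  \<open>wedge_pow_q\<close> reduces to the plain power.\<close>

lemma exp_W_Suc: "m \<in> W (Suc k) \<Longrightarrow> m [^] q = \<one>"
proof (induction "5 - k" arbitrary: k m)
  case 0
  then have "m = \<one>" by (intro W_trivial[OF 0(2)]) simp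
  then show ?case by simp
next
  case (Suc n)
  have IH: "m [^] q = \<one>" if "m \<in> W (Suc (Suc k))" for m
    using Suc.hyps(1)[of "Suc k"] Suc.hyps(2) that by simp
  show ?case
  proof (rule exp_W[OF IH _ Suc.prems])
    fix g h assume g: "g \<in> lcs G (Suc k)" and h: "h \<in> carrier G"
    have "fold diff [h, h, h, h] (wedge g h) = \<one>"
      using fold_diff_trivial[of "[h, h, h, h]" "wedge g h" "Suc k"] wedge_W[OF g h] h by simp
    then show "wedge g h [^] q = \<one>"
      using wedge_pow_q[OF IH g h] G.lcs_closed[OF g] h by simp
  qed
qed

section \<open>Elimination of the fourth difference at the bottom level\<close>

lemma wedge_mult_pow_right:
  assumes y: "y \<in> carrier G" and x: "x \<in> carrier G"
  shows "wedge y (x \<otimes>\<^bsub>G\<^esub> y [^]\<^bsub>G\<^esub> (i::nat)) = wedge y x"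
proof -
  have "wedge y (y [^]\<^bsub>G\<^esub> i) = \<one>"
    using y by (induction i) (simp_all add: wedge_mult_right)
  then show ?thesis using x y by (simp add: wedge_mult_right)
qed

text \<open>Replacing \<open>x\<close> by \<open>x y ^ i\<close> leaves \<open>wedge y x\<close>
  fixed, so by \<open>wedge_pow_q\<close> a polynomial of degree 4 in \<open>i\<close> takes one
  value \<open>K\<close> throughout. Power sums over the residues modulo 5 extract its leading
  coefficient.\<close>

lemma fold_diff_left_pow:
  assumes x: "x \<in> carrier G" and y: "y \<in> carrier G"
  shows "fold diff [y, y, y, y] (wedge y x) [^] (q choose 5) = \<one>"
proof -
  define r where "r = q choose 5"
  define f where "f i = fold diff (replicate 4 (x \<otimes>\<^bsub>G\<^esub> y [^]\<^bsub>G\<^esub> i)) (wedge y x)" for i :: nat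
  define K where "K = inv (wedge y x [^] q)"
  have [simp]: "K \<in> carrier M" using x y by (simp add: K_def)
  have wedge: "wedge y x \<in> W (4 - 4)"
    using x y by (simp add: W_0)
  obtain A where A: "\<And>l. A l \<in> W 4" "A (4::nat) = fold diff (replicate 4 y) (wedge y x)" and
    Ai: "\<And>i. f i = A 0 \<otimes> (A 1 [^] i \<otimes> (A 2 [^] i\<^sup>2 \<otimes> (A 3 [^] i ^ 3 \<otimes> A 4 [^] i ^ 4)))"
    using fold_diff_polynomial[OF x y wedge order_refl] unfolding f_def by blast
  note [simp] = A(1) A(1)[THEN W_carrier]
  define B where "B l = A l [^] r" for l
  have B: "B l \<in> W 4" for l by (simp add: B_def W_pow)
  note [simp] = B B[THEN W_carrier]
  have B5: "B l [^] (5::nat) = \<one>" for l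
  proof -
    \<comment> \<open>The index 3 stands for \<open>W (Suc 3)\<close>, the group \<open>W 4\<close>
      that contains the coefficients. As \<open>q\<close> divides \<open>5 * r\<close>, their
      \<open>r\<close>-th powers have order dividing 5.\<close>
    have "A l [^] q = \<one>" by (rule exp_W_Suc[of _ 3]) simp
    then have "A l [^] (5 * r) = \<one>"
      by (rule M.pow_eq_one_dvd[OF W_carrier[OF A(1)]]) (use q_dvd(4) in \<open>simp add: r_def\<close>)
    then show ?thesis by (simp add: B_def M.nat_pow_pow mult.commute)
  qed
  have B_dvd: "B l [^] n = \<one>" if "5 dvd n" for l and n :: nat
    by (rule M.pow_eq_one_dvd[OF _ B5 that]) simp
  \<comment> \<open>The nonconstant part with independent exponents, so that the values at different
    \<open>i\<close> multiply by adding exponent vectors.\<close>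
  define R where "R a b c d = B 1 [^] a \<otimes> (B 2 [^] b \<otimes> (B 3 [^] c \<otimes> B 4 [^] d))" for a b c d :: nat
  have R_closed [simp]: "R a b c d \<in> carrier M" for a b c d
    by (simp add: R_def)
  have R_mult: "R a b c d \<otimes> R a' b' c' d' = R (a + a') (b + b') (c + c') (d + d')" for a b c d a' b' c' d'
    unfolding R_def by (simp add: W_pow W_mult W_4_ac W_carrier M.m_assoc M.nat_pow_mult[symmetric])
  have BR: "B 0 \<otimes> R i (i\<^sup>2) (i ^ 3) (i ^ 4) = K" for i
  proof -
    have "wedge y x [^] q \<otimes> f i [^] r = \<one>"
      using wedge_pow_q[of 0 y "x \<otimes>\<^bsub>G\<^esub> y [^]\<^bsub>G\<^esub> i"] exp_W_Suc[of _ 0] x y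
      by (simp add: wedge_mult_pow_right f_def r_def eval_nat_numeral)
    moreover have f_mem: "f i \<in> carrier M"
      by (simp add: Ai)
    ultimately have "f i [^] r = K"
      using x y unfolding K_def by (metis M.inv_equality M.inv_inv M.inv_closed M.nat_pow_closed wedge_closed)
    moreover have "f i [^] r = B 0 \<otimes> R i (i\<^sup>2) (i ^ 3) (i ^ 4)"
      by (simp add: Ai R_def B_def W_4_pow_mult W_pow W_mult M.nat_pow_pow mult.commute)
    ultimately show ?thesis by simp
  qed
  have "B 0 = K"
    using BR[of 0] by (simp add: R_def)
  then have R_one: "R i (i\<^sup>2) (i ^ 3) (i ^ 4) = \<one>" for i
    using BR[of i] M.l_cancel_one[of "B 0" "R i (i\<^sup>2) (i ^ 3) (i ^ 4)"] by simp
  \<comment> \<open>\<open>0\<^sup>k + 1\<^sup>k + 2\<^sup>k + 3\<^sup>k + 4\<^sup>k\<close> vanishes modulo 5 for \<open>0 < k < 4\<close> but not for \<open>k = 4\<close>\<close>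
  have "R 10 30 100 354 = R 1 1 1 1 \<otimes> (R 2 4 8 16 \<otimes> (R 3 9 27 81 \<otimes> R 4 16 64 256))"
    by (simp add: R_mult)
  also have "\<dots> = \<one>"
    using R_one[of 1] R_one[of 2] R_one[of 3] R_one[of 4] by simp
  finally have "B 4 [^] (354::nat) = \<one>"
    by (simp add: R_def B_dvd)
  \<comment> \<open>354 is congruent to -1 modulo 5, so the next power is trivial as well, and the
    quotient of the two is \<open>B 4\<close> itself.\<close>
  moreover have "B 4 [^] Suc 354 = \<one>"
    by (rule B_dvd) simp
  ultimately have "B 4 = \<one>"
    unfolding M.nat_pow_Suc by simp
  moreover have "fold diff [y, y, y, y] (wedge y x) = A 4"
    unfolding A(2) by (simp add: eval_nat_numeral)
  ultimately show ?thesis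
    by (simp only: B_def r_def)
qed

text \<open>The previous lemma with \<open>x\<close> and \<open>y\<close> exchanged concerns
  \<open>wedge x y\<close>, the inverse of \<open>wedge y x\<close>. On \<open>W 0\<close> the
  operator \<open>diff x\<close> is not multiplicative, but its defect \<open>w\<close> lies in
  \<open>W 2\<close> and the three remaining differences kill it. So the two fourth differences are
  inverse to each other.\<close>

lemma fold_diff_right_pow:
  assumes x: "x \<in> carrier G" and y: "y \<in> carrier G"
  shows "fold diff [x, x, x, x] (wedge y x) [^] (q choose 5) = \<one>"
proof -
  define F where "F = fold diff [x, x, x]"
  define c c' where "c = wedge y x" and "c' = wedge x y"
  define w where "w = diff (bd (inv c')) (diff x c)"
  have [simp]: "c \<in> carrier M" "c' \<in> carrier M" using x y by (simp_all add: c_def c'_def)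
  have dc: "diff x c \<in> W 1" "diff x c' \<in> W 1"
    using diff_W_Suc[OF x, of _ 0] by (simp_all add: W_0)
  have w: "w \<in> W 2"
    using diff_W_Suc[OF _ dc(1), of "bd (inv c')"] by (simp add: w_def numeral_2_eq_2)
  have "c \<otimes> c' = \<one>"
    using x y wedge_swap[of x y] by (simp add: c_def c'_def)
  then have "F (diff x c \<otimes> (w \<otimes> diff x c')) = F \<one>"
    using diff_mult_commutator[OF x, of c c'] x by (simp add: w_def)
  moreover have "F w = \<one>" "F \<one> = \<one>"
    using fold_diff_trivial[of "[x, x, x]" w 2] fold_diff_trivial[of "[x, x, x]" \<one> 2] w x
    by (simp_all add: F_def)
  moreover have F4: "F (diff x c) \<in> W 4" "F (diff x c') \<in> W 4"
    using fold_diff_W[of "[x, x, x]" _ 1] dc x by (simp_all add: F_def eval_nat_numeral)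
  moreover have "F (a \<otimes> b) = F a \<otimes> F b" if "a \<in> W 1" "b \<in> W 1" for a b
    unfolding F_def by (rule fold_diff_mult[OF _ that]) (use x in auto)
  then have "F (diff x c \<otimes> (w \<otimes> diff x c')) = F (diff x c) \<otimes> (F w \<otimes> F (diff x c'))"
    using dc W_le[OF w, of 1] by (simp add: W_mult)
  ultimately have "F (diff x c) \<otimes> F (diff x c') = \<one>"
    by (simp add: W_carrier)
  then have "(F (diff x c) \<otimes> F (diff x c')) [^] (q choose 5) = \<one>"
    by simp
  moreover have "F (diff x c') [^] (q choose 5) = \<one>"
    using fold_diff_left_pow[OF y x] by (simp add: F_def c'_def)
  ultimately have "F (diff x c) [^] (q choose 5) = \<one>"
    using F4 by (simp add: W_4_pow_mult W_carrier)
  then show ?thesis by (simp add: F_def c_def)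
qed

lemma pow_q_eq_one:
  assumes "m \<in> carrier M"
  shows "m [^] q = \<one>"
proof (rule exp_W[of 0, OF exp_W_Suc])
  fix g h assume "g \<in> lcs G 0" "h \<in> carrier G"
  then show "wedge g h [^] q = \<one>"
    using wedge_pow_q[of 0 g h, OF exp_W_Suc] fold_diff_right_pow[of h g] by simp
qed (use assms in \<open>simp_all add: W_0\<close>)

end

section \<open>The presented exterior square\<close>

definition exterior_wedge :: "('a, 'b) monoid_scheme \<Rightarrow> 'a \<Rightarrow> 'a \<Rightarrow> ('a \<times> 'a) word set"
  where "exterior_wedge G g h =
    word_class (tensor_relators G \<union> {[(True, (g, g))] | g. g \<in> carrier G}) [(True, (g, h))]"

text \<open>The universal property of the exterior square: the hypotheses on \<open>p\<close> say
  exactly that all relators evaluate to the identity.\<close>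

lemma (in group) exterior_square_lift:
  fixes L :: "('l, 'm) monoid_scheme"
  assumes "group L"
    and p_closed: "\<And>g h. g \<in> carrier G \<Longrightarrow> h \<in> carrier G \<Longrightarrow> p g h \<in> carrier L"
    and p_left: "\<And>g g' h. g \<in> carrier G \<Longrightarrow> g' \<in> carrier G \<Longrightarrow> h \<in> carrier G
      \<Longrightarrow> p (g \<otimes> g') h = p (conj G g g') (conj G g h) \<otimes>\<^bsub>L\<^esub> p g h"
    and p_right: "\<And>g h h'. g \<in> carrier G \<Longrightarrow> h \<in> carrier G \<Longrightarrow> h' \<in> carrier G
      \<Longrightarrow> p g (h \<otimes> h') = p g h \<otimes>\<^bsub>L\<^esub> p (conj G h g) (conj G h h')"
    and p_self: "\<And>g. g \<in> carrier G \<Longrightarrow> p g g = \<one>\<^bsub>L\<^esub>"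
  shows "\<exists>f \<in> hom (exterior_square G) L. \<forall>g\<in>carrier G. \<forall>h\<in>carrier G. f (exterior_wedge G g h) = p g h"
proof -
  interpret L: group L by fact
  define R where "R = tensor_relators G \<union> {[(True, (g, g))] | g. g \<in> carrier G}"
  \<comment> \<open>Evaluation of words needs a value in L for every letter, so pairs outside the
    carrier get the identity.\<close>
  define p' where "p' = (\<lambda>(g, h). if g \<in> carrier G \<and> h \<in> carrier G then p g h else \<one>\<^bsub>L\<^esub>)"
  have p'_closed: "p' x \<in> carrier L" for x
    by (auto simp: p'_def p_closed split: prod.splits)
  have R_val: "word_val L p' r = \<one>\<^bsub>L\<^esub>" if "r \<in> R" for r
    using that unfolding R_def tensor_relators_def
    by (auto simp: p'_def p_closed p_left p_right p_self L.m_assoc L.inv_mult_group)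
  have "presentation_lift L p' \<in> hom (exterior_square G) L"
    unfolding exterior_square_def R_def[symmetric]
    by (rule L.presentation_lift_hom[OF p'_closed R_val])
  moreover have "presentation_lift L p' (word_class R [(True, x)]) = p' x" for x
    by (rule L.presentation_lift_letter[OF p'_closed R_val])
  then have "presentation_lift L p' (exterior_wedge G g h) = p g h"
    if "g \<in> carrier G" "h \<in> carrier G" for g h
    using that by (simp add: exterior_wedge_def R_def p'_def)
  ultimately show ?thesis by blast
qed

lemma (in group) eq_mult_of_quotient:
  assumes "a \<otimes> inv b \<otimes> inv c = \<one>" "a \<in> carrier G" "b \<in> carrier G" "c \<in> carrier G"
  shows "a = c \<otimes> b"
proof -
  have "a = a \<otimes> inv b \<otimes> inv c \<otimes> c \<otimes> b"
    using assms(2-4) by (simp add: m_assoc)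
  then show ?thesis using assms by simp
qed

text \<open>Both maps come from the universal property: \<open>act x\<close> from conjugating both
  arguments, with the exterior square as target, and \<open>bd\<close> from the commutator, with G
  as target.\<close>

lemma (in group) exterior_square_pairing:
  "\<exists>act bd. exterior_pairing G (exterior_square G) (exterior_wedge G) act bd"
proof -
  define R where "R = tensor_relators G \<union> {[(True, (g, g))] | g. g \<in> carrier G}"
  interpret E: group "exterior_square G"
    unfolding exterior_square_def by (rule group_presentation)
  have wedge: "exterior_wedge G g h = word_class R [(True, (g, h))]" for g h
    by (simp add: exterior_wedge_def R_def)
  have E: "exterior_square G = presentation (carrier G \<times> carrier G) R"
    by (simp add: exterior_square_def R_def)
  have closed [simp]: "exterior_wedge G g h \<in> carrier (exterior_square G)"
    if "g \<in> carrier G" "h \<in> carrier G" for g h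
    unfolding E wedge presentation_carrier using that by (intro imageI) simp
  have relator: "word_class R r = \<one>\<^bsub>exterior_square G\<^esub>" if "r \<in> R" for r
    unfolding E presentation_one word_class_eq_iff using that by (rule weq_rel)
  have letters: "word_class R [(True, (a, b)), (False, (c, d)), (False, (e, f))] =
      exterior_wedge G a b \<otimes>\<^bsub>exterior_square G\<^esub> inv\<^bsub>exterior_square G\<^esub> exterior_wedge G c d
      \<otimes>\<^bsub>exterior_square G\<^esub> inv\<^bsub>exterior_square G\<^esub> exterior_wedge G e f"
    if "c \<in> carrier G" "d \<in> carrier G" "e \<in> carrier G" "f \<in> carrier G" for a b c d e f
    unfolding E wedge using that
    by (simp add: presentation_inv_letter presentation_mult)
  have left: "exterior_wedge G (g \<otimes> g') h =
      exterior_wedge G (conj G g g') (conj G g h) \<otimes>\<^bsub>exterior_square G\<^esub> exterior_wedge G g h"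
    if "g \<in> carrier G" "g' \<in> carrier G" "h \<in> carrier G" for g g' h
  proof -
    have "[(True, (g \<otimes> g', h)), (False, (g, h)), (False, (conj G g g', conj G g h))] \<in> R"
      using that by (auto simp: R_def tensor_relators_def)
    from relator[OF this] show ?thesis
      using that by (intro E.eq_mult_of_quotient) (simp_all add: letters)
  qed
  have right: "exterior_wedge G g (h \<otimes> h') =
      exterior_wedge G g h \<otimes>\<^bsub>exterior_square G\<^esub> exterior_wedge G (conj G h g) (conj G h h')"
    if "g \<in> carrier G" "h \<in> carrier G" "h' \<in> carrier G" for g h h'
  proof -
    have "[(True, (g, h \<otimes> h')), (False, (conj G h g, conj G h h')), (False, (g, h))] \<in> R"
      using that by (auto simp: R_def tensor_relators_def)
    from relator[OF this] show ?thesis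
      using that by (intro E.eq_mult_of_quotient) (simp_all add: letters)
  qed
  have self: "exterior_wedge G g g = \<one>\<^bsub>exterior_square G\<^esub>" if "g \<in> carrier G" for g
    unfolding wedge using that by (intro relator) (auto simp: R_def)
  have "\<exists>f \<in> hom (exterior_square G) (exterior_square G). \<forall>g\<in>carrier G. \<forall>h\<in>carrier G.
      f (exterior_wedge G g h) = exterior_wedge G (conj G x g) (conj G x h)" if "x \<in> carrier G" for x
    by (rule exterior_square_lift[OF E.is_group])
      (use that in \<open>simp_all add: conj_mult left right self conj_conj\<close>)
  then obtain act where act: "\<And>x. x \<in> carrier G \<Longrightarrow> act x \<in> hom (exterior_square G) (exterior_square G)"
    "\<And>x g h. x \<in> carrier G \<Longrightarrow> g \<in> carrier G \<Longrightarrow> h \<in> carrier G \<Longrightarrow>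
      act x (exterior_wedge G g h) = exterior_wedge G (conj G x g) (conj G x h)"
    by metis
  have "\<exists>f \<in> hom (exterior_square G) G. \<forall>g\<in>carrier G. \<forall>h\<in>carrier G.
      f (exterior_wedge G g h) = commutator G g h"
    by (rule exterior_square_lift[OF is_group])
      (simp_all add: commutator_mult_left commutator_mult_right)
  then obtain bd where bd: "bd \<in> hom (exterior_square G) G"
    "\<And>g h. g \<in> carrier G \<Longrightarrow> h \<in> carrier G \<Longrightarrow> bd (exterior_wedge G g h) = commutator G g h"
    by blast
  have gen: "carrier (exterior_square G) = generate (exterior_square G)
      {exterior_wedge G g h | g h. g \<in> carrier G \<and> h \<in> carrier G}"
  proof -
    have "(\<lambda>x. word_class R [(True, x)]) ` (carrier G \<times> carrier G) =
        {exterior_wedge G g h | g h. g \<in> carrier G \<and> h \<in> carrier G}"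
      by (auto simp: wedge)
    then show ?thesis
      using presentation_generate[of "carrier G \<times> carrier G" R] by (simp add: E)
  qed
  have "exterior_pairing G (exterior_square G) (exterior_wedge G) act bd"
    by unfold_locales (simp_all add: act bd left right self flip: gen)
  then show ?thesis by blast
qed

section \<open>Group exponents and divisibility of binomial coefficients\<close>

lemma (in group) pow_mod_eq_one:
  "x \<in> carrier G \<Longrightarrow> x [^] (n::nat) = \<one> \<Longrightarrow> x [^] (k::nat) = \<one> \<Longrightarrow> x [^] (k mod n) = \<one>"
proof -
  assume x: "x \<in> carrier G" "x [^] n = \<one>" "x [^] k = \<one>"
  have "x [^] k = x [^] (n * (k div n)) \<otimes> x [^] (k mod n)"
    using x(1) by (simp add: nat_pow_mult)
  then show ?thesis
    using x by (simp flip: nat_pow_pow)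
qed

lemma (in group) group_exponent_dvd:
  assumes "0 < k" and pow: "\<And>x. x \<in> carrier G \<Longrightarrow> x [^] (k::nat) = \<one>"
  shows "group_exponent G dvd k" "0 < group_exponent G"
    "\<And>x. x \<in> carrier G \<Longrightarrow> x [^] group_exponent G = \<one>"
proof -
  let ?P = "\<lambda>n::nat. 0 < n \<and> (\<forall>x\<in>carrier G. x [^] n = \<one>)"
  have k: "?P k" using assms by blast
  then have e: "group_exponent G = (LEAST n. ?P n)"
    unfolding group_exponent_def by (intro if_P) blast
  have P: "?P (group_exponent G)"
    unfolding e using k by (rule LeastI)
  then show "0 < group_exponent G" "\<And>x. x \<in> carrier G \<Longrightarrow> x [^] group_exponent G = \<one>"
    by auto
  have "k mod group_exponent G < group_exponent G"
    using P by simp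
  then have "\<not> ?P (k mod group_exponent G)"
    unfolding e by (rule not_less_Least)
  moreover have "x [^] (k mod group_exponent G) = \<one>" if "x \<in> carrier G" for x
    using that P pow[OF that] by (simp only: pow_mod_eq_one)
  then have "\<forall>x\<in>carrier G. x [^] (k mod group_exponent G) = \<one>" ..
  ultimately have "k mod group_exponent G = 0"
    by simp
  then show "group_exponent G dvd k"
    by (rule mod_0_imp_dvd)
qed

text \<open>The absorption identity: k times (q choose k) is q times (q - 1 choose k - 1).\<close>

lemma dvd_mult_choose: "0 < k \<Longrightarrow> q dvd k * (q choose k)"
  by (simp add: times_binomial_minus1_eq)

lemma dvd_choose: "0 < k \<Longrightarrow> coprime q k \<Longrightarrow> q dvd q choose k"
  using dvd_mult_choose[of k q] by (simp add: coprime_dvd_mult_right_iff)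

theorem theorem3p14:
  fixes G :: "('a, 'b) monoid_scheme"
  assumes "group G"
    and "finite (carrier G)"
    and "\<exists>k. order G = 5 ^ k"
    and "nilpotency_class G 5"
  shows "group_exponent (exterior_square G) dvd group_exponent G"
proof -
  interpret group G by fact
  obtain k where k: "order G = 5 ^ k" using assms(3) by blast
  define q where "q = group_exponent G"
  have "q dvd 5 ^ k" and pos: "0 < q" and pow_q: "\<And>x. x \<in> carrier G \<Longrightarrow> x [^]\<^bsub>G\<^esub> q = \<one>\<^bsub>G\<^esub>"
    using group_exponent_dvd[of "5 ^ k"] pow_order_eq_1 k by (simp_all add: q_def)
  \<comment> \<open>As a divisor of a power of 5, \<open>q\<close> is coprime to 2, 3 and 4, so it
    divides the corresponding binomial coefficients. For index 5 only absorption remains, which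
    gives the factor 5 in the last divisibility.\<close>
  then have "coprime q j" if "coprime 5 j" for j
    using that coprime_divisors[of q "5 ^ k" j j] by simp
  moreover have "coprime 5 (2::nat)" "coprime 5 (3::nat)" "coprime 5 (4::nat)"
    by (simp_all add: coprime_iff_gcd_eq_1 gcd_non_0_nat)
  ultimately have coprime: "coprime q 2" "coprime q 3" "coprime q 4"
    by blast+
  obtain act bd where "exterior_pairing G (exterior_square G) (exterior_wedge G) act bd"
    using exterior_square_pairing by blast
  then interpret P: exterior_pairing G "exterior_square G" "exterior_wedge G" act bd .
  interpret P: exterior_pairing_class5 G "exterior_square G" "exterior_wedge G" act bd q
  proof
    show "lcs G 5 = {\<one>\<^bsub>G\<^esub>}"
      using assms(4) by (simp add: nilpotency_class_def)
    show "q dvd q choose 2" "q dvd q choose 3" "q dvd q choose 4"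
      using coprime by (simp_all add: dvd_choose)
    show "q dvd 5 * (q choose 5)"
      by (rule dvd_mult_choose) simp
  qed (rule pow_q)
  show ?thesis
    using P.M.group_exponent_dvd(1)[OF pos P.pow_q_eq_one] by (simp add: q_def)
qed

end
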